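(* Let $\mathcal Z=\{\bm z\in\mathbb R^{d_{\bm z}}\mid c_\ell(\bm z)\le 0\ \forall \ell\in\mathcal L\}$ be nonempty, where $\mathcal L=\{1,\dots,L\}$ and each $c_\ell:\mathbb R^{d_{\bm z}}\to\overline{\mathbb R}$ is proper, closed and convex. Let $\mathcal I=\{1,\dots,I\}$, $\mathcal I_0=\{0,\dots,I\}$, and for every $i\in\mathcal I_0$ let $f_i:\mathbb R^{d_{\bm x}}\times\mathbb R^{d_{\bm z}}\to\overline{\mathbb R}$ be such that $f_i(\cdot,\bm z)$ is proper, closed and convex for every fixed $\bm z$ and $-f_i(\bm x,\cdot)$ is proper, closed and convex for every fixed $\bm x$. Consider the primal worst problem $$\text{(P-W)}\qquad \inf_{\bm x\in\mathbb R^{d_{\bm x}}}\Big\{\sup_{\bm z_0\in\mathcal Z}f_0(\bm x,\bm z_0)\ \Big|\ \sup_{\bm z_i\in\mathcal Z}f_i(\bm x,\bm z_i)\le 0\ \ \forall i\in\mathcal I\Big\}$$ and the dual best problem $$\text{(D-B)}\qquad \sup\Big\{-f_0^{*1}(\bm w_0,\bm z_0)-\sum_{i\in\mathcal I}\lambda_i f_i^{*1}(\bm w_i/\lambda_i,\bm z_i)\ \Big|\ \sum_{i\in\mathcal I_0}\bm w_i=\bm 0,\ \bm w_i\in\mathbb R^{d_{\bm x}},\ \bm z_i\in\mathcal Z\ \forall i\in\mathcal I_0,\ \bm\lambda\in\mathbb R^I,\ \bm\lambda\ge\bm 0\Big\}.$$ Then the following hold. (i) If (P-W) admits a strict Slater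 point and $\mathcal Z$ is bounded, then the infimum of (P-W) coincides with the supremum of (D-B), and (D-B) is solvable. (ii) If the feasible region of (P-W) is nonempty and bounded and $\mathcal Z$ is bounded, then the infimum of (P-W) coincides with the supremum of (D-B), and (P-W) is solvable. (iii) If (D-B) admits a strict Slater point, then its supremum coincides with the infimum of (P-W), and (P-W) is solvable.
   Context: $\overline{\mathbb R}=[-\infty,+\infty]$. For $f:\mathbb R^d\to\overline{\mathbb R}$: $\mathrm{dom}(f)=\{\bm x\mid f(\bm x)<+\infty\}$; $f$ is proper if $f>-\infty$ everywhere and $\mathrm{dom}(f)\ne\emptyset$; $f$ is closed if it is lower semicontinuous and either $f>-\infty$ everywhere or $f\equiv-\infty$. The support function of a set $\mathcal X$ is $\delta^*_{\mathcal X}(\bm w)=\sup_{\bm x\in\mathcal X}\bm x^\top\bm w$. Partial conjugate: $f^{*1}(\bm w,\bm z)=\sup_{\bm x}\{\bm w^\top\bm x-f(\bm x,\bm z)\}$. Partial perspective in (D-B): for $\lambda_i>0$ the expression $\lambda_i f_i^{*1}(\bm w_i/\lambda_i,\bm z_i)$ has its usual meaning, and for $\lambda_i=0$ it denotes $\delta^*_{\mathrm{dom}((f_i^{*1})^{*1}(\cdot,\bm z_i))}(\bm w_i)=\delta^*_{\mathrm{dom}(f_i(\cdot,\bm z_i))}(\bm w_i)$; it is regarded as $+\infty$ for $\lambda_i<0$ when domains are considered. Optimization conventions: a solution (any assignment of real values to the decision variables) is feasible if it satisfies all constraints and its objective value is not $+\infty$ (minimization) or not $-\infty$ (maximization); the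 feasible region is the set of feasible solutions. A feasible problem is solvable if its optimal value is attained by a feasible solution; an infeasible problem is regarded as solved by any solution (hence solvable), and its optimal value is $+\infty$ (minimization) or $-\infty$ (maximization). Slater points: let $\mathcal X=\{\bm x\mid g_i(\bm x)\le 0\ \forall i,\ h_j(\bm x)=0\ \forall j\}$ be a set with this given representation. $\bm x^{\rm S}$ is a strict Slater point of $\mathcal X$ if (a) it lies in $\mathrm{ri}(\mathrm{dom}(g_i))$ and $\mathrm{ri}(\mathrm{dom}(h_j))$ for all $i,j$, (b) $\bm x^{\rm S}\in\mathcal X$, and (c) $g_i(\bm x^{\rm S})<0$ for all $i$. A strict Slater point of $\inf\{g_0(\bm x)\mid\bm x\in\mathcal X\}$ [respectively $\sup\{g_0(\bm x)\mid\bm x\in\mathcal X\}$] is a strict Slater point of $\mathcal X$ that lies in $\mathrm{ri}(\mathrm{dom}(g_0))$ [respectively $\mathrm{ri}(\mathrm{dom}(-g_0))$]. Here $\mathrm{ri}$ denotes relative interior (interior relative to the affine hull). For (P-W) the objective and constraint functions are $\bm x\mapsto\sup_{\bm z\in\mathcal Z}f_i(\bm x,\bm z)$; for (D-B) the inequality constraints are $c_\ell(\bm z_i)\le 0$ ($i\in\mathcal I_0$, $\ell\in\mathcal L$) and $-\lambda_i\le 0$ ($i\in\mathcal I$). *)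

theory Defs
  imports "HOL-Analysis.Analysis"
begin

definition edom :: "('a \<Rightarrow> ereal) \<Rightarrow> 'a set" where
  "edom f = {x. f x < \<infinity>}"

definition proper_fun :: "('a \<Rightarrow> ereal) \<Rightarrow> bool" where
  "proper_fun f \<longleftrightarrow> (\<forall>x. f x > -\<infinity>) \<and> edom f \<noteq> {}"

definition lsc_fun :: "('a::topological_space \<Rightarrow> ereal) \<Rightarrow> bool" where
  "lsc_fun f \<longleftrightarrow> (\<forall>x. f x \<le> Liminf (at x) f)"

definition closed_fun :: "('a::topological_space \<Rightarrow> ereal) \<Rightarrow> bool" where
  "closed_fun f \<longleftrightarrow> lsc_fun f \<and> ((\<forall>x. f x > -\<infinity>) \<or> (\<forall>x. f x = -\<infinity>))"

text \<open>Convexity is convexity of the epigraph, so that no sum of opposite infinities occurs.\<close>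

definition convex_fun :: "('a::real_vector \<Rightarrow> ereal) \<Rightarrow> bool" where
  "convex_fun f \<longleftrightarrow> convex {(x, t::real). f x \<le> ereal t}"

definition support_fun :: "'a::real_inner set \<Rightarrow> 'a \<Rightarrow> ereal" where
  "support_fun X w = (SUP x\<in>X. ereal (x \<bullet> w))"

definition conj1 :: "('x::real_inner \<Rightarrow> 'z \<Rightarrow> ereal) \<Rightarrow> 'x \<Rightarrow> 'z \<Rightarrow> ereal" where
  "conj1 f w z = (SUP x. ereal (w \<bullet> x) - f x z)"

text \<open>
  Partial perspective of \<open>g\<close>, with \<open>z\<close> left unscaled. For \<open>g = conj1 f\<close> with every
  \<open>f(\<cdot>,z)\<close> proper, closed and convex, the set at \<open>l = 0\<close> is the domain of \<open>f(\<cdot>,z)\<close>.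
\<close>

definition persp1 :: "('x::real_inner \<Rightarrow> 'z \<Rightarrow> ereal) \<Rightarrow> real \<Rightarrow> 'x \<Rightarrow> 'z \<Rightarrow> ereal" where
  "persp1 g l w z =
     (if l > 0 then ereal l * g (w /\<^sub>R l) z
      else if l = 0 then support_fun (edom (\<lambda>x. conj1 g x z)) w
      else \<infinity>)"

text \<open>
  A problem is given by an objective \<open>g0\<close>, a set \<open>G\<close> of functions constrained to be nonpositive
  and a set \<open>H\<close> of functions constrained to vanish.
\<close>

definition constr_set :: "('a \<Rightarrow> ereal) set \<Rightarrow> ('a \<Rightarrow> ereal) set \<Rightarrow> 'a set" where
  "constr_set G H = {x. (\<forall>g\<in>G. g x \<le> 0) \<and> (\<forall>h\<in>H. h x = 0)}"

definition strict_slater ::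
  "('a::euclidean_space \<Rightarrow> ereal) set \<Rightarrow> ('a \<Rightarrow> ereal) set \<Rightarrow> 'a \<Rightarrow> bool" where
  "strict_slater G H x \<longleftrightarrow>
     (\<forall>g\<in>G \<union> H. x \<in> rel_interior (edom g)) \<and> x \<in> constr_set G H \<and> (\<forall>g\<in>G. g x < 0)"

definition strict_slater_min ::
  "('a::euclidean_space \<Rightarrow> ereal) \<Rightarrow> ('a \<Rightarrow> ereal) set \<Rightarrow> ('a \<Rightarrow> ereal) set \<Rightarrow> 'a \<Rightarrow> bool" where
  "strict_slater_min g0 G H x \<longleftrightarrow> strict_slater G H x \<and> x \<in> rel_interior (edom g0)"

definition strict_slater_max ::
  "('a::euclidean_space \<Rightarrow> ereal) \<Rightarrow> ('a \<Rightarrow> ereal) set \<Rightarrow> ('a \<Rightarrow> ereal) set \<Rightarrow> 'a \<Rightarrow> bool" where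
  "strict_slater_max g0 G H x \<longleftrightarrow> strict_slater G H x \<and> x \<in> rel_interior (edom (\<lambda>y. - g0 y))"

definition feasible_min ::
  "('a \<Rightarrow> ereal) \<Rightarrow> ('a \<Rightarrow> ereal) set \<Rightarrow> ('a \<Rightarrow> ereal) set \<Rightarrow> 'a set" where
  "feasible_min g0 G H = {x \<in> constr_set G H. g0 x \<noteq> \<infinity>}"

definition feasible_max ::
  "('a \<Rightarrow> ereal) \<Rightarrow> ('a \<Rightarrow> ereal) set \<Rightarrow> ('a \<Rightarrow> ereal) set \<Rightarrow> 'a set" where
  "feasible_max g0 G H = {x \<in> constr_set G H. g0 x \<noteq> -\<infinity>}"

text \<open>In \<^typ>\<open>ereal\<close>, \<open>Inf {} = \<infinity>\<close> and \<open>Sup {} = -\<infinity>\<close>: the optimal values of infeasible problems.\<close>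

definition val_min ::
  "('a \<Rightarrow> ereal) \<Rightarrow> ('a \<Rightarrow> ereal) set \<Rightarrow> ('a \<Rightarrow> ereal) set \<Rightarrow> ereal" where
  "val_min g0 G H = (INF x\<in>constr_set G H. g0 x)"

definition val_max ::
  "('a \<Rightarrow> ereal) \<Rightarrow> ('a \<Rightarrow> ereal) set \<Rightarrow> ('a \<Rightarrow> ereal) set \<Rightarrow> ereal" where
  "val_max g0 G H = (SUP x\<in>constr_set G H. g0 x)"

definition solvable_min ::
  "('a \<Rightarrow> ereal) \<Rightarrow> ('a \<Rightarrow> ereal) set \<Rightarrow> ('a \<Rightarrow> ereal) set \<Rightarrow> bool" where
  "solvable_min g0 G H \<longleftrightarrow>
     feasible_min g0 G H = {} \<or> (\<exists>x\<in>feasible_min g0 G H. g0 x = val_min g0 G H)"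

definition solvable_max ::
  "('a \<Rightarrow> ereal) \<Rightarrow> ('a \<Rightarrow> ereal) set \<Rightarrow> ('a \<Rightarrow> ereal) set \<Rightarrow> bool" where
  "solvable_max g0 G H \<longleftrightarrow>
     feasible_max g0 G H = {} \<or> (\<exists>x\<in>feasible_max g0 G H. g0 x = val_max g0 G H)"

definition unc_set :: "nat \<Rightarrow> (nat \<Rightarrow> 'z \<Rightarrow> ereal) \<Rightarrow> 'z set" where
  "unc_set L c = {z. \<forall>l\<in>{1..L}. c l z \<le> 0}"

text \<open>
  The index set \<open>{0,\<dots>,I}\<close> is a finite type \<open>'n\<close> with a distinguished element \<open>o\<^sub>0\<close> in the
  role of \<open>0\<close>; the constraint indices \<open>{1,\<dots>,I}\<close> are \<open>- {o\<^sub>0}\<close>, which may be empty.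
\<close>

definition PW_fun ::
  "('n \<Rightarrow> 'x \<Rightarrow> 'z \<Rightarrow> ereal) \<Rightarrow> 'z set \<Rightarrow> 'n \<Rightarrow> 'x \<Rightarrow> ereal" where
  "PW_fun f Z i x = (SUP z\<in>Z. f i x z)"

definition PW_ineqs ::
  "('n \<Rightarrow> 'x \<Rightarrow> 'z \<Rightarrow> ereal) \<Rightarrow> 'z set \<Rightarrow> 'n \<Rightarrow> ('x \<Rightarrow> ereal) set" where
  "PW_ineqs f Z o\<^sub>0 = PW_fun f Z ` (- {o\<^sub>0})"

text \<open>
  A dual solution is a triple \<open>(w, z, \<lambda>)\<close>. As \<open>\<lambda>\<close> is indexed by \<open>- {o\<^sub>0}\<close> only, the space
  of multipliers is realized as the vectors over \<open>'n\<close> whose superfluous entry at \<open>o\<^sub>0\<close> is fixed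
  to zero by an additional equality constraint. No other function depends on that entry, so
  relative interiors of domains are unaffected by it.
\<close>

type_synonym ('x, 'z, 'n) dual = "('x ^ 'n) \<times> ('z ^ 'n) \<times> (real ^ 'n)"

definition DB_obj ::
  "('n \<Rightarrow> 'x::euclidean_space \<Rightarrow> 'z \<Rightarrow> ereal) \<Rightarrow> 'n::finite \<Rightarrow> ('x, 'z, 'n) dual \<Rightarrow> ereal" where
  "DB_obj f o\<^sub>0 = (\<lambda>(w, z, l).
     - conj1 (f o\<^sub>0) (w $ o\<^sub>0) (z $ o\<^sub>0)
     - (\<Sum>i\<in>- {o\<^sub>0}. persp1 (conj1 (f i)) (l $ i) (w $ i) (z $ i)))"

definition DB_ineqs ::
  "nat \<Rightarrow> (nat \<Rightarrow> 'z \<Rightarrow> ereal) \<Rightarrow> 'n::finite \<Rightarrow> (('x, 'z, 'n) dual \<Rightarrow> ereal) set" where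
  "DB_ineqs L c o\<^sub>0 =
     {(\<lambda>(w, z, l). c k (z $ i)) | k i. k \<in> {1..L}} \<union>
     {(\<lambda>(w, z, l). ereal (- (l $ i))) | i. i \<in> - {o\<^sub>0}}"

text \<open>The vector equation \<open>\<Sum>i. w $ i = 0\<close> is stated componentwise.\<close>

definition DB_eqs :: "'n::finite \<Rightarrow> (('x::euclidean_space, 'z, 'n) dual \<Rightarrow> ereal) set" where
  "DB_eqs o\<^sub>0 =
     {(\<lambda>(w, z, l). ereal ((\<Sum>i\<in>UNIV. w $ i) \<bullet> b)) | b. b \<in> Basis} \<union>
     {(\<lambda>(w, z, l). ereal (l $ o\<^sub>0))}"

lemma constr_set_PW:
  "x \<in> constr_set (PW_ineqs f Z o\<^sub>0) {} \<longleftrightarrow> (\<forall>i. i \<noteq> o\<^sub>0 \<longrightarrow> (SUP z\<in>Z. f i x z) \<le> 0)"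
  by (auto simp: constr_set_def PW_ineqs_def PW_fun_def)

lemma constr_set_DB:
  fixes w :: "'x::euclidean_space ^ 'n::finite" and z :: "'b ^ 'n"
  shows "(w, z, l) \<in> constr_set (DB_ineqs L c o\<^sub>0) (DB_eqs o\<^sub>0) \<longleftrightarrow>
     (\<Sum>i\<in>UNIV. w $ i) = 0 \<and> (\<forall>i. z $ i \<in> unc_set L c) \<and>
     (\<forall>i. i \<noteq> o\<^sub>0 \<longrightarrow> 0 \<le> l $ i) \<and> l $ o\<^sub>0 = 0"
proof -
  let ?s = "(w, z, l)"
  have ineq: "(\<forall>g\<in>{(\<lambda>(w::'x ^ 'n, z, l::real ^ 'n). c k (z $ i)) | k i. k \<in> {1..L}}. g ?s \<le> 0)
      \<longleftrightarrow> (\<forall>i. \<forall>k\<in>{1..L}. c k (z $ i) \<le> 0)"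
    by (simp only: Ball_def mem_Collect_eq) (metis (mono_tags, lifting) case_prod_conv)
  have mult: "(\<forall>g\<in>{(\<lambda>(w::'x ^ 'n, z::'b ^ 'n, l). ereal (- (l $ i))) | i. i \<in> - {o\<^sub>0}}. g ?s \<le> 0)
      \<longleftrightarrow> (\<forall>i. i \<noteq> o\<^sub>0 \<longrightarrow> 0 \<le> l $ i)"
    by auto
  have eqs: "(\<forall>h\<in>{(\<lambda>(w::'x ^ 'n, z::'b ^ 'n, l::real ^ 'n). ereal ((\<Sum>i\<in>UNIV. w $ i) \<bullet> b)) | b. b \<in> Basis}.
        h ?s = 0) \<longleftrightarrow> (\<forall>b\<in>Basis. (\<Sum>i\<in>UNIV. w $ i) \<bullet> b = 0)"
    by auto
  have "(\<Sum>i\<in>UNIV. w $ i) = 0 \<longleftrightarrow> (\<forall>b\<in>Basis. (\<Sum>i\<in>UNIV. w $ i) \<bullet> b = 0)"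
    by (metis euclidean_all_zero_iff)
  moreover have "(w, z, l) \<in> constr_set (DB_ineqs L c o\<^sub>0) (DB_eqs o\<^sub>0) \<longleftrightarrow>
     (\<forall>b\<in>Basis. (\<Sum>i\<in>UNIV. w $ i) \<bullet> b = 0) \<and> (\<forall>i. \<forall>k\<in>{1..L}. c k (z $ i) \<le> 0) \<and>
     (\<forall>i. i \<noteq> o\<^sub>0 \<longrightarrow> 0 \<le> l $ i) \<and> l $ o\<^sub>0 = 0"
    unfolding constr_set_def DB_ineqs_def DB_eqs_def mem_Collect_eq
    by (simp only: ball_Un ineq mult eqs) auto
  ultimately show ?thesis by (simp add: unc_set_def)
qed

end

theory Submission
  imports Defs
begin

text \<open>
  Properness in both arguments makes every \<open>f\<^sub>i\<close> finite. Put \<open>lagr x (z, l) = \<Sum>i. l\<^sub>i f\<^sub>i(x, z\<^sub>i)\<close> with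
  \<open>l = 1\<close> at the objective. The primal value is \<open>inf\<^sub>x sup lagr\<close>, and Fenchel duality for a sum of
  finite convex functions identifies the dual value with \<open>sup inf\<^sub>x lagr\<close>. The Lagrangian is convex
  in \<open>x\<close> and concave-like in \<open>(z, l)\<close>, so \<open>u \<mapsto> inf lagr*(u, \<cdot>)\<close> is a convex function whose value
  at \<open>0\<close> is minus the dual value. If \<open>0\<close> lies in the relative interior of its domain, a
  subgradient at \<open>0\<close> is a primal solution. A dual Slater point gives this condition, and so does
  a bounded feasible region, because otherwise the feasible region contains a ray. If
  \<open>Z\<close> is compact, a primal Slater point bounds the multipliers, so the epigraph is closed and the
  dual supremum is attained.
\<close>

section \<open>Subgradients of convex value functions\<close>

text \<open>The slope comes from a hyperplane that separates \<open>E\<close> from the part of the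
  vertical axis below \<open>m\<close>, thickened by the orthogonal complement \<open>N\<close> of
  the projection of \<open>E\<close>. The relative interior condition excludes a vertical
  hyperplane; dividing by the positive coefficient \<beta> turns the normal into a slope.\<close>

lemma convex_set_subgradient_at_0:
  fixes E :: "('u::euclidean_space \<times> real) set"
  assumes E: "convex E" and ri: "0 \<in> rel_interior (fst ` E)"
    and m: "\<And>r. (0, r) \<in> E \<Longrightarrow> m \<le> r"
  obtains a where "\<And>u r. (u, r) \<in> E \<Longrightarrow> m + a \<bullet> u \<le> r"
proof -
  let ?S = "fst ` E"
  define N where "N = {n. \<forall>u\<in>?S. n \<bullet> u = 0}"
  have S: "convex ?S" using E by (rule convex_linear_image[OF linear_fst])
  have ri': "\<exists>e>1. (1 - e) *\<^sub>R u \<in> ?S" if "u \<in> ?S" for u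
    using convex_rel_interior_iff[OF S, of 0] ri that by auto
  \<comment> \<open>Thickening by \<open>N\<close> excludes vertical separating hyperplanes that contain all of \<open>E\<close>.\<close>
  let ?T = "N \<times> {..<m}"
  have N0: "0 \<in> N" by (simp add: N_def)
  have "convex N" by (auto simp: N_def convex_def inner_add_left)
  then have T: "convex ?T" by (intro convex_Times) auto
  have "E \<inter> ?T = {}"
  proof (rule ccontr)
    assume "E \<inter> ?T \<noteq> {}"
    then obtain u r where ur: "(u, r) \<in> E" "u \<in> N" "r < m" by auto
    then have "u \<bullet> u = 0" by (force simp: N_def)
    then show False using ur m by force
  qed
  moreover have "?T \<noteq> {}" using N0 by (auto intro: exI[of _ "m - 1"])
  moreover have "E \<noteq> {}" using ri rel_interior_subset by fastforce
  ultimately obtain p b where p0: "p \<noteq> 0"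
    and pE: "\<forall>x\<in>E. b \<le> p \<bullet> x" and pT: "\<forall>x\<in>?T. p \<bullet> x \<le> b"
    using separating_hyperplane_sets[OF T E] by blast
  obtain a \<beta> where p: "p = (a, \<beta>)" by (cases p)
  have E': "b \<le> a \<bullet> u + \<beta> * r" if "(u, r) \<in> E" for u r
    using pE that p by auto
  have T': "a \<bullet> n + \<beta> * r \<le> b" if "n \<in> N" "r < m" for n r
    using pT that p by auto
  have "\<beta> \<ge> 0"
  proof (rule ccontr)
    assume "\<not> \<beta> \<ge> 0"
    then have neg: "\<beta> < 0" by simp
    \<comment> \<open>The second set is unbounded below in its last coordinate, so a negative
      \<beta> would push \<open>\<beta> * r\<close> above \<open>b\<close>.\<close>
    define r where "r = min (m - 1) ((b + 1) / \<beta>)"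
    have "\<beta> * r \<ge> b + 1"
      using neg by (simp add: r_def min_def field_simps mult_left_mono_neg)
    moreover have "\<beta> * r \<le> b" using T'[OF N0, of r] by (simp add: r_def)
    ultimately show False by simp
  qed
  moreover have "\<beta> \<noteq> 0"
  proof
    assume b0: "\<beta> = 0"
    have nonneg: "0 \<le> a \<bullet> u" if "u \<in> ?S" for u
      using that E' T'[OF N0, of "m - 1"] b0 by fastforce
    \<comment> \<open>Each \<open>u\<close> in the projection can be prolonged through
      \<open>0\<close>, so a linear form that is nonnegative there vanishes there. The whole line
      through \<open>a\<close> then lies in \<open>N\<close>, where the form is bounded by
      \<open>b\<close>, and this forces \<open>a = 0\<close>.\<close>
    have "a \<in> N"
      unfolding N_def
    proof clarify
      fix u r assume "(u, r) \<in> E"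
      then have u: "u \<in> ?S" by force
      then obtain e where "e > 1" "(1 - e) *\<^sub>R u \<in> ?S" using ri' by blast
      then have "0 \<le> (1 - e) * (a \<bullet> u)" using nonneg by fastforce
      then have "a \<bullet> u \<le> 0" using \<open>e > 1\<close> by (simp add: zero_le_mult_iff)
      then show "a \<bullet> fst (u, r) = 0" using nonneg[OF u] by simp
    qed
    then have "t *\<^sub>R a \<in> N" for t by (simp add: N_def)
    then have le: "t * (a \<bullet> a) \<le> b" for t
      using T'[of "t *\<^sub>R a" "m - 1"] b0 by simp
    have "a \<noteq> 0" using p0 p b0 by (auto simp: zero_prod_def)
    then show False using le[of "(b + 1) / (a \<bullet> a)"] by simp
  qed
  ultimately have pos: "\<beta> > 0" by simp
  have bm: "\<beta> * m \<le> b"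
  proof (rule field_le_epsilon)
    fix e :: real assume "e > 0"
    then show "\<beta> * m \<le> b + e"
      using T'[OF N0, of "m - e / \<beta>"] pos by (simp add: algebra_simps)
  qed
  have "m + (- a /\<^sub>R \<beta>) \<bullet> u \<le> r" if "(u, r) \<in> E" for u r
    using E'[OF that] bm pos by (simp add: field_simps)
  then show ?thesis using that by blast
qed

text \<open>The epigraph of a finite function, translated to \<open>x0\<close>, projects onto the
  whole space, so \<open>0\<close> is interior to the projection.\<close>

lemma convex_subgradient_exists:
  fixes g :: "'a::euclidean_space \<Rightarrow> real"
  assumes g: "convex_on UNIV g"
  obtains a where "\<And>x. g x0 + a \<bullet> (x - x0) \<le> g x"
proof -
  define E where "E = {(u, r). g (x0 + u) \<le> r}"
  have "convex E"
    unfolding convex_alt E_def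
  proof clarsimp
    fix u r u' r' t :: real and v v' :: 'a
    assume *: "g (x0 + v) \<le> r" "g (x0 + v') \<le> r'" "0 \<le> t" "t \<le> 1"
    have "g ((1 - t) *\<^sub>R (x0 + v) + t *\<^sub>R (x0 + v')) \<le> (1 - t) * g (x0 + v) + t * g (x0 + v')"
      using convex_onD[OF g] * by blast
    also have "\<dots> \<le> (1 - t) * r + t * r'"
      using * by (intro add_mono mult_left_mono) auto
    finally show "g (x0 + ((1 - t) *\<^sub>R v + t *\<^sub>R v')) \<le> (1 - t) * r + t * r'"
      by (simp add: algebra_simps)
  qed
  moreover have "fst ` E = UNIV" by (force simp: E_def)
  moreover have "g x0 \<le> r" if "(0, r) \<in> E" for r using that by (simp add: E_def)
  ultimately obtain a where a: "\<And>u r. (u, r) \<in> E \<Longrightarrow> g x0 + a \<bullet> u \<le> r"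
    using convex_set_subgradient_at_0[of E "g x0"] by auto
  have "g x0 + a \<bullet> (x - x0) \<le> g x" for x
    using a[of "x - x0" "g x"] by (simp add: E_def)
  then show ?thesis using that by blast
qed

text \<open>The supremum of a sum whose terms have independent arguments is the sum of the suprema.
  Fixing all arguments but one shows that the supremum \<open>S\<close> of one term is finite, and
  the induction continues with the bound \<open>r - S\<close>.\<close>

lemma separable_upper_bound:
  fixes \<phi> :: "'i \<Rightarrow> 'a \<Rightarrow> real"
  assumes "finite A" "\<And>x. (\<Sum>i\<in>A. \<phi> i (x i)) \<le> r"
  obtains s where "(\<Sum>i\<in>A. s i) \<le> r" "\<And>i x. i \<in> A \<Longrightarrow> \<phi> i x \<le> s i"
proof -
  have "\<exists>s. (\<Sum>i\<in>A. s i) \<le> r \<and> (\<forall>i\<in>A. \<forall>x. \<phi> i x \<le> s i)"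
    using assms
  proof (induction A arbitrary: r rule: finite_induct)
    case empty
    then show ?case by simp
  next
    case (insert j A)
    have split: "\<phi> j x + (\<Sum>i\<in>A. \<phi> i (y i)) \<le> r" for x y
    proof -
      have "(\<Sum>i\<in>A. \<phi> i ((y(j := x)) i)) = (\<Sum>i\<in>A. \<phi> i (y i))"
        using insert.hyps by (intro sum.cong) auto
      then show ?thesis using insert.prems[of "y(j := x)"] insert.hyps by simp
    qed
    then have le: "\<phi> j x \<le> r - (\<Sum>i\<in>A. \<phi> i (y i))" for x y
      by (simp add: algebra_simps)
    define S where "S = (SUP x. \<phi> j x)"
    have "bdd_above (range (\<phi> j))" by (intro bdd_aboveI2) (rule le)
    then have upper: "\<phi> j x \<le> S" for x unfolding S_def by (rule cSUP_upper[rotated]) simp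
    have "S \<le> r - (\<Sum>i\<in>A. \<phi> i (y i))" for y
      unfolding S_def using le by (intro cSUP_least) auto
    then have "(\<Sum>i\<in>A. \<phi> i (y i)) \<le> r - S" for y
      by (simp add: algebra_simps)
    from insert.IH[OF this] obtain s
      where s: "(\<Sum>i\<in>A. s i) \<le> r - S" "\<forall>i\<in>A. \<forall>x. \<phi> i x \<le> s i" by blast
    have "(\<Sum>i\<in>A. (s(j := S)) i) = (\<Sum>i\<in>A. s i)"
      using insert.hyps by (intro sum.cong) auto
    then show ?case
      using s upper insert.hyps by (intro exI[of _ "s(j := S)"]) auto
  qed
  then show ?thesis using that by blast
qed

text \<open>Perturb the argument of each \<open>g i\<close> separately by \<open>p $ i\<close> and
  minimize over the common point \<open>x0\<close>. The resulting convex value function has a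
  subgradient at \<open>p = 0\<close>, because the \<open>g i\<close> are finite, and its components
  are the required \<open>w $ i\<close>.\<close>

lemma conjugate_sum_split:
  fixes g :: "'n::finite \<Rightarrow> 'x::euclidean_space \<Rightarrow> real"
  assumes g: "\<And>i. convex_on UNIV (g i)" and r: "\<And>x. u \<bullet> x - (\<Sum>i\<in>UNIV. g i x) \<le> r"
  obtains w :: "'x ^ 'n" and s where "(\<Sum>i\<in>UNIV. w $ i) = u" "(\<Sum>i\<in>UNIV. s i) \<le> r"
    "\<And>i x. w $ i \<bullet> x - g i x \<le> s i"
proof -
  define E where "E = {(p :: 'x ^ 'n, t). \<exists>x0. (\<Sum>i\<in>UNIV. g i (x0 + p $ i)) - u \<bullet> x0 \<le> t}"
  have "convex E"
    unfolding convex_alt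
  proof (intro ballI allI impI)
    fix P Q and l :: real
    assume PQ: "P \<in> E" "Q \<in> E" and "0 \<le> l \<and> l \<le> 1"
    then have l: "0 \<le> l" "l \<le> 1" by auto
    obtain p t x0 where P: "P = (p, t)" "(\<Sum>i\<in>UNIV. g i (x0 + p $ i)) - u \<bullet> x0 \<le> t"
      using PQ(1) by (auto simp: E_def)
    obtain q t' x1 where Q: "Q = (q, t')" "(\<Sum>i\<in>UNIV. g i (x1 + q $ i)) - u \<bullet> x1 \<le> t'"
      using PQ(2) by (auto simp: E_def)
    define x2 where "x2 = (1 - l) *\<^sub>R x0 + l *\<^sub>R x1"
    have "g i (x2 + ((1 - l) *\<^sub>R p + l *\<^sub>R q) $ i)
        \<le> (1 - l) * g i (x0 + p $ i) + l * g i (x1 + q $ i)" for i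
    proof -
      have "x2 + ((1 - l) *\<^sub>R p + l *\<^sub>R q) $ i = (1 - l) *\<^sub>R (x0 + p $ i) + l *\<^sub>R (x1 + q $ i)"
        by (simp add: x2_def algebra_simps)
      then show ?thesis using convex_onD[OF g l(1,2), of "x0 + p $ i" "x1 + q $ i" i] by simp
    qed
    then have "(\<Sum>i\<in>UNIV. g i (x2 + ((1 - l) *\<^sub>R p + l *\<^sub>R q) $ i))
        \<le> (\<Sum>i\<in>UNIV. (1 - l) * g i (x0 + p $ i) + l * g i (x1 + q $ i))"
      by (rule sum_mono)
    also have "\<dots> = (1 - l) * (\<Sum>i\<in>UNIV. g i (x0 + p $ i)) + l * (\<Sum>i\<in>UNIV. g i (x1 + q $ i))"
      by (simp add: sum.distrib sum_distrib_left)
    finally have "(\<Sum>i\<in>UNIV. g i (x2 + ((1 - l) *\<^sub>R p + l *\<^sub>R q) $ i)) - u \<bullet> x2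
        \<le> (1 - l) * ((\<Sum>i\<in>UNIV. g i (x0 + p $ i)) - u \<bullet> x0)
          + l * ((\<Sum>i\<in>UNIV. g i (x1 + q $ i)) - u \<bullet> x1)"
      by (simp add: x2_def algebra_simps)
    also have "\<dots> \<le> (1 - l) * t + l * t'"
      using P Q l by (intro add_mono mult_left_mono) auto
    finally show "(1 - l) *\<^sub>R P + l *\<^sub>R Q \<in> E"
      unfolding E_def P Q by (auto intro!: exI[of _ x2])
  qed
  moreover have "fst ` E = UNIV"
  proof -
    have "p \<in> fst ` E" for p
      by (rule image_eqI[of _ _ "(p, \<Sum>i\<in>UNIV. g i (0 + p $ i))"]) (auto simp: E_def intro!: exI[of _ 0])
    then show ?thesis by auto
  qed
  moreover have "- r \<le> t" if "(0, t) \<in> E" for t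
  proof -
    from that obtain x0 where "(\<Sum>i\<in>UNIV. g i x0) - u \<bullet> x0 \<le> t" by (auto simp: E_def)
    then show ?thesis using r[of x0] by simp
  qed
  ultimately obtain w where w: "\<And>p t. (p, t) \<in> E \<Longrightarrow> - r + w \<bullet> p \<le> t"
    using convex_set_subgradient_at_0[of E "- r"] by auto
  \<comment> \<open>Taking \<open>p $ i = x i - x0\<close> makes the arguments of the
    \<open>g i\<close> independent of \<open>x0\<close>, which then occurs only linearly.\<close>
  have key: "(\<Sum>i\<in>UNIV. w $ i \<bullet> x i - g i (x i)) + (u - (\<Sum>i\<in>UNIV. w $ i)) \<bullet> x0 \<le> r" for x x0
  proof -
    have "((\<chi> i. x i - x0), (\<Sum>i\<in>UNIV. g i (x i)) - u \<bullet> x0) \<in> E"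
      by (auto simp: E_def intro!: exI[of _ x0])
    from w[OF this] have "- r + (\<Sum>i\<in>UNIV. w $ i \<bullet> (x i - x0)) \<le> (\<Sum>i\<in>UNIV. g i (x i)) - u \<bullet> x0"
      by (simp add: inner_vec_def)
    moreover have "(\<Sum>i\<in>UNIV. w $ i \<bullet> (x i - x0))
        = (\<Sum>i\<in>UNIV. w $ i \<bullet> x i) - (\<Sum>i\<in>UNIV. w $ i) \<bullet> x0"
      by (simp add: inner_diff_right sum_subtractf inner_sum_left)
    ultimately show ?thesis by (simp add: sum_subtractf inner_diff_left)
  qed
  \<comment> \<open>A linear form in \<open>x0\<close> that is bounded above must be zero.\<close>
  define d where "d = u - (\<Sum>i\<in>UNIV. w $ i)"
  have "d = 0"
  proof (rule ccontr)
    assume "d \<noteq> 0"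
    define K where "K = r - (\<Sum>i\<in>UNIV. w $ i \<bullet> 0 - g i 0)"
    have "t * (d \<bullet> d) \<le> K" for t
      using key[of "\<lambda>_. 0" "t *\<^sub>R d"] by (simp add: d_def[symmetric] K_def)
    from this[of "(K + 1) / (d \<bullet> d)"] show False using \<open>d \<noteq> 0\<close> by simp
  qed
  then have "(\<Sum>i\<in>UNIV. w $ i \<bullet> x i - g i (x i)) \<le> r" for x
    using key[of x 0] by simp
  from separable_upper_bound[of UNIV "\<lambda>i x. w $ i \<bullet> x - g i x", OF _ this]
  obtain s where "(\<Sum>i\<in>UNIV. s i) \<le> r" "\<And>i x. w $ i \<bullet> x - g i x \<le> s i" by auto
  moreover have "(\<Sum>i\<in>UNIV. w $ i) = u" using \<open>d = 0\<close> by (simp add: d_def)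
  ultimately show ?thesis using that by blast
qed

section \<open>Minimax theorems for concave-like families\<close>

text \<open>Concavity in the second argument is required only up to domination by some element of
  \<open>Y\<close>, because the Lagrangian is in general not concave in the pair of parameters and
  multipliers.\<close>

locale convex_concavelike =
  fixes h :: "'x::euclidean_space \<Rightarrow> 'y \<Rightarrow> real" and Y :: "'y set"
  assumes Y_nonempty: "Y \<noteq> {}"
    and convex: "\<And>y. y \<in> Y \<Longrightarrow> convex_on UNIV (\<lambda>x. h x y)"
    and concavelike: "\<And>y1 y2 t. y1 \<in> Y \<Longrightarrow> y2 \<in> Y \<Longrightarrow> 0 \<le> t \<Longrightarrow> t \<le> 1 \<Longrightarrow>
      \<exists>y\<in>Y. \<forall>x. (1 - t) * h x y1 + t * h x y2 \<le> h x y"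
begin

text \<open>
  Up to closure this is the epigraph of \<open>u \<mapsto> inf\<^sub>y h*(u, y)\<close>, where \<open>h*\<close> is the conjugate in the
  first argument. Its value at \<open>0\<close> is minus the dual value.
\<close>

definition conj_epi :: "('x \<times> real) set" where
  "conj_epi = {(u, r). \<exists>y\<in>Y. \<forall>x. u \<bullet> x - h x y \<le> r}"

lemma conj_epi_upward: "(u, r) \<in> conj_epi \<Longrightarrow> r \<le> r' \<Longrightarrow> (u, r') \<in> conj_epi"
  unfolding conj_epi_def by clarsimp (meson order_trans)

lemma convex_conj_epi: "convex conj_epi"
  unfolding convex_alt
proof (intro ballI allI impI)
  fix P Q and t :: real
  assume PQ: "P \<in> conj_epi" "Q \<in> conj_epi" and "0 \<le> t \<and> t \<le> 1"
  then have t: "0 \<le> t" "t \<le> 1" by auto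
  obtain u r y where P: "P = (u, r)" "y \<in> Y" "\<And>x. u \<bullet> x - h x y \<le> r"
    using PQ(1) by (auto simp: conj_epi_def)
  obtain u' r' y' where Q: "Q = (u', r')" "y' \<in> Y" "\<And>x. u' \<bullet> x - h x y' \<le> r'"
    using PQ(2) by (auto simp: conj_epi_def)
  obtain y2 where y2: "y2 \<in> Y" "\<And>x. (1 - t) * h x y + t * h x y' \<le> h x y2"
    using concavelike[OF P(2) Q(2) t] by blast
  have "((1 - t) *\<^sub>R u + t *\<^sub>R u') \<bullet> x - h x y2 \<le> (1 - t) * r + t * r'" for x
  proof -
    have "((1 - t) *\<^sub>R u + t *\<^sub>R u') \<bullet> x - h x y2
        \<le> (1 - t) * (u \<bullet> x - h x y) + t * (u' \<bullet> x - h x y')"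
      using y2(2)[of x] by (simp add: inner_add_left algebra_simps)
    also have "\<dots> \<le> (1 - t) * r + t * r'"
      using P Q t by (intro add_mono mult_left_mono) auto
    finally show ?thesis .
  qed
  then show "(1 - t) *\<^sub>R P + t *\<^sub>R Q \<in> conj_epi"
    using y2(1) by (auto simp: conj_epi_def P Q)
qed

text \<open>At a subgradient \<open>u\<close> of \<open>h\<close> in its first argument, the
  Fenchel-Young inequality is an equality. These points of \<open>conj_epi\<close> turn affine
  inequalities on \<open>conj_epi\<close> back into bounds on \<open>h\<close>.\<close>

lemma conj_epi_subgradient:
  assumes "y \<in> Y"
  obtains u where "(u, u \<bullet> x - h x y) \<in> conj_epi" "\<And>x'. h x y + u \<bullet> (x' - x) \<le> h x' y"
proof -
  obtain u where u: "\<And>x'. h x y + u \<bullet> (x' - x) \<le> h x' y"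
    using convex_subgradient_exists[OF convex[OF assms], of x] by blast
  have "u \<bullet> x' - h x' y \<le> u \<bullet> x - h x y" for x'
    using u[of x'] by (simp add: inner_diff_right)
  then have "(u, u \<bullet> x - h x y) \<in> conj_epi"
    using assms by (auto simp: conj_epi_def)
  then show ?thesis using that u by blast
qed

text \<open>The solution is itself a subgradient at \<open>0\<close> of the value function whose
  epigraph \<open>conj_epi\<close> represents.\<close>

theorem primal_attained:
  assumes ri: "0 \<in> rel_interior (fst ` conj_epi)"
    and v: "\<And>y r. y \<in> Y \<Longrightarrow> (\<And>x. r \<le> h x y) \<Longrightarrow> r \<le> v"
  obtains x where "\<And>y. y \<in> Y \<Longrightarrow> h x y \<le> v"
proof -
  have "- v \<le> r" if r: "(0, r) \<in> conj_epi" for r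
  proof -
    obtain y where y: "y \<in> Y" "\<forall>x. - h x y \<le> r"
      using r by (auto simp: conj_epi_def)
    have "- r \<le> v" using y by (intro v[of y]) (simp_all add: minus_le_iff)
    then show ?thesis by simp
  qed
  then obtain a where a: "\<And>u r. (u, r) \<in> conj_epi \<Longrightarrow> - v + a \<bullet> u \<le> r"
    using convex_set_subgradient_at_0[OF convex_conj_epi ri, of "- v"] by blast
  have "h a y \<le> v" if y: "y \<in> Y" for y
  proof -
    obtain u where "(u, u \<bullet> a - h a y) \<in> conj_epi"
      using conj_epi_subgradient[OF y] by blast
    \<comment> \<open>The two inner products of \<open>a\<close> and \<open>u\<close>
      cancel.\<close>
    from a[OF this] show ?thesis by (simp add: inner_commute)
  qed
  then show ?thesis using that by blast
qed

text \<open>A hyperplane through \<open>0\<close> has all of the projection of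
  \<open>conj_epi\<close> on one side. That projection contains every subgradient of every member of
  the family, so all members are nonincreasing in the direction opposite to the normal
  \<open>a\<close>.\<close>

lemma recession_direction:
  assumes "0 \<notin> rel_interior (fst ` conj_epi)"
  obtains a where "a \<noteq> 0" "\<And>x y t. y \<in> Y \<Longrightarrow> 0 \<le> t \<Longrightarrow> h (x - t *\<^sub>R a) y \<le> h x y"
proof -
  let ?S = "fst ` conj_epi"
  have S: "convex ?S" by (rule convex_linear_image[OF linear_fst convex_conj_epi])
  obtain a where a: "a \<noteq> 0" "\<forall>u\<in>rel_interior ?S. 0 \<le> a \<bullet> u"
    using separating_hyperplane_set_0[OF convex_rel_interior[OF S] assms] by blast
  have "closed {u. 0 \<le> a \<bullet> u}" using closed_halfspace_ge[of 0 a] by simp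
  then have "closure (rel_interior ?S) \<subseteq> {u. 0 \<le> a \<bullet> u}"
    using a(2) by (intro closure_minimal) auto
  then have "closure ?S \<subseteq> {u. 0 \<le> a \<bullet> u}"
    by (simp add: convex_closure_rel_interior[OF S])
  then have nonneg: "0 \<le> a \<bullet> u" if "u \<in> ?S" for u
    using that closure_subset[of ?S] by (simp add: subset_iff)
  have "h (x - t *\<^sub>R a) y \<le> h x y" if y: "y \<in> Y" and t: "0 \<le> t" for x y t
  proof -
    obtain u r where u: "(u, r) \<in> conj_epi"
      "\<And>x'. h (x - t *\<^sub>R a) y + u \<bullet> (x' - (x - t *\<^sub>R a)) \<le> h x' y"
      using conj_epi_subgradient[OF y] by blast
    have "0 \<le> a \<bullet> u" using u(1) by (intro nonneg) force
    then have "0 \<le> t * (u \<bullet> a)" using t by (simp add: inner_commute)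
    then show ?thesis using u(2)[of x] by simp
  qed
  then show ?thesis using that a(1) by blast
qed

text \<open>If \<open>(0, - m)\<close> were outside the closed convex set \<open>conj_epi\<close>,
  it could be strictly separated. A nonvertical hyperplane yields a point where the supremum over
  \<open>Y\<close> is below \<open>m\<close>; a vertical one yields a direction from
  \<open>x0\<close> in which all members decrease at a common positive rate.\<close>

theorem dual_attained:
  assumes closed: "closed conj_epi" and bound: "\<forall>y\<in>Y. h x0 y \<le> M"
    and lower: "\<forall>x v. (\<forall>y\<in>Y. h x y \<le> v) \<longrightarrow> m \<le> v"
  shows "\<exists>y\<in>Y. \<forall>x. m \<le> h x y"
proof -
  have M: "h x0 y \<le> M" if "y \<in> Y" for y using bound that by blast
  have m: "m \<le> v" if "\<And>y. y \<in> Y \<Longrightarrow> h x y \<le> v" for x v using lower that by blast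
  have "(0, - m) \<in> conj_epi"
  proof (rule ccontr)
    assume "(0, - m) \<notin> conj_epi"
    then obtain p b where p: "p \<bullet> (0, - m) < b" "\<forall>q\<in>conj_epi. b < p \<bullet> q"
      using separating_hyperplane_closed_point[OF convex_conj_epi closed] by blast
    obtain a \<beta> where pa: "p = (a, \<beta>)" by (cases p)
    have lt: "- (\<beta> * m) < b" using p(1) pa by simp
    have sep: "b < a \<bullet> u + \<beta> * r" if "(u, r) \<in> conj_epi" for u r
      using p(2) that pa by auto
    obtain y0 where y0: "y0 \<in> Y" using Y_nonempty by blast
    obtain u0 r0 where u0: "(u0, r0) \<in> conj_epi" using conj_epi_subgradient[OF y0] by blast
    have "\<beta> \<ge> 0"
    proof (rule ccontr)
      assume "\<not> \<beta> \<ge> 0"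
      then have neg: "\<beta> < 0" by simp
      \<comment> \<open>\<open>conj_epi\<close> is closed upwards, so a negative \<beta> would
        violate the separation for large \<open>r\<close>.\<close>
      define r where "r = max r0 ((b - a \<bullet> u0) / \<beta>)"
      have "\<beta> * r \<le> b - a \<bullet> u0"
        using neg by (simp add: r_def max_def field_simps mult_left_mono_neg)
      moreover have "b < a \<bullet> u0 + \<beta> * r"
        using conj_epi_upward[OF u0] by (intro sep) (simp add: r_def)
      ultimately show False by simp
    qed
    then consider "\<beta> > 0" | "\<beta> = 0" by linarith
    then show False
    proof cases
      case 1
      have "h (- a /\<^sub>R \<beta>) y \<le> - b / \<beta>" if y: "y \<in> Y" for y
      proof -
        obtain u where "(u, u \<bullet> (- a /\<^sub>R \<beta>) - h (- a /\<^sub>R \<beta>) y) \<in> conj_epi"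
          using conj_epi_subgradient[OF y] by blast
        from sep[OF this] 1 show ?thesis by (simp add: inner_commute field_simps)
      qed
      then have "m \<le> - b / \<beta>" by (rule m)
      then show False using lt 1 by (simp add: field_simps)
    next
      case 2
      \<comment> \<open>With this step length the bound \<open>M - t * b\<close> equals
        \<open>m - 1\<close>.\<close>
      define t where "t = (M - m + 1) / b"
      have b: "b > 0" using lt 2 by simp
      have "m \<le> M" using m M by blast
      then have t: "t > 0" using b by (simp add: t_def)
      have "h (x0 - t *\<^sub>R a) y \<le> M - t * b" if y: "y \<in> Y" for y
      proof -
        obtain u r where u: "(u, r) \<in> conj_epi"
          "\<And>x'. h (x0 - t *\<^sub>R a) y + u \<bullet> (x' - (x0 - t *\<^sub>R a)) \<le> h x' y"
          using conj_epi_subgradient[OF y] by blast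
        have "b < u \<bullet> a" using sep[OF u(1)] 2 by (simp add: inner_commute)
        then have "t * b \<le> t * (u \<bullet> a)" using t by simp
        then show ?thesis using u(2)[of x0] M[OF y] by simp
      qed
      then have "m \<le> M - t * b" by (rule m)
      then show False using b by (simp add: t_def)
    qed
  qed
  then show ?thesis by (simp add: conj_epi_def)
qed

end

section \<open>The robust problem and its dual\<close>

lemma convex_on_of_convex_fun:
  assumes "convex_fun (\<lambda>x. ereal (g x))"
  shows "convex_on UNIV g"
proof -
  have *: "(1 - t) *\<^sub>R (x, g x) + t *\<^sub>R (y, g y) \<in> {(x, t). ereal (g x) \<le> ereal t}"
    if "0 \<le> t" "t \<le> 1" for t x y
    using assms that unfolding convex_fun_def by (intro convexD) auto
  show ?thesis
  proof (rule convex_onI)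
    fix t :: real and x y
    assume "0 < t" "t < 1"
    then show "g ((1 - t) *\<^sub>R x + t *\<^sub>R y) \<le> (1 - t) * g x + t * g y"
      using *[of t x y] by simp
  qed simp
qed

lemma convex_sublevel:
  assumes "convex_fun g"
  shows "convex {x. g x \<le> ereal b}"
proof -
  have "convex ((\<lambda>x. (x, b)) -` {(x, t). g x \<le> ereal t})"
    unfolding convex_alt
  proof clarsimp
    fix x y and u :: real
    assume "g x \<le> ereal b" "g y \<le> ereal b" "0 \<le> u" "u \<le> 1"
    then have "(1 - u) *\<^sub>R (x, b) + u *\<^sub>R (y, b) \<in> {(x, t). g x \<le> ereal t}"
      using assms unfolding convex_fun_def by (intro convexD) auto
    then show "g ((1 - u) *\<^sub>R x + u *\<^sub>R y) \<le> ereal b"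
      by (simp add: algebra_simps)
  qed
  then show ?thesis by (simp add: vimage_def)
qed

text \<open>\<open>lsc_fun\<close> uses the punctured lower limit, which matches the description of
  closed sets by limit points.\<close>

lemma closed_sublevel:
  fixes g :: "'a::topological_space \<Rightarrow> ereal"
  assumes "lsc_fun g"
  shows "closed {x. g x \<le> b}"
  unfolding closed_limpt
proof (intro allI impI)
  fix x assume limpt: "x islimpt {x. g x \<le> b}"
  show "x \<in> {x. g x \<le> b}"
  proof (rule ccontr)
    assume "x \<notin> {x. g x \<le> b}"
    then have "b < g x" by simp
    then have "eventually (\<lambda>y. b < g y) (at x)"
      using assms unfolding lsc_fun_def le_Liminf_iff by blast
    moreover have "frequently (\<lambda>y. g y \<le> b) (at x)"
      using limpt by (simp add: islimpt_conv_frequently_at)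
    ultimately have "frequently (\<lambda>y. g y \<le> b \<and> b < g y) (at x)"
      using frequently_eventually_frequently by blast
    then show False by (auto dest: frequently_ex)
  qed
qed

text \<open>The approach to \<open>s\<close> may be along any curve in the affine hull; the dual
  Slater argument needs one that is not straight.\<close>

lemma rel_interior_eventually:
  assumes "s \<in> rel_interior D" "(p \<longlongrightarrow> s) F" "eventually (\<lambda>t. p t \<in> affine hull D) F"
  shows "eventually (\<lambda>t. p t \<in> D) F"
proof -
  obtain T where "open T" "s \<in> T" "T \<inter> affine hull D \<subseteq> D"
    using assms(1) by (auto simp: mem_rel_interior)
  then show ?thesis
    using topological_tendstoD[OF assms(2), of T] assms(3) by (auto elim: eventually_elim2)
qed

lemma sum_neq_MInf:
  fixes a :: "'n \<Rightarrow> ereal"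
  assumes "\<And>i. i \<in> A \<Longrightarrow> a i \<noteq> -\<infinity>"
  shows "sum a A \<noteq> -\<infinity>"
  using assms by (induction A rule: infinite_finite_induct) auto

text \<open>Replaces an extended-real sum by real bounds on its terms. Without terms equal to minus
  infinity, a real bound on the sum forces every term to be finite.\<close>

lemma sum_ereal_le_iff:
  fixes a :: "'n \<Rightarrow> ereal"
  assumes "finite A" "\<And>i. i \<in> A \<Longrightarrow> a i \<noteq> -\<infinity>"
  shows "sum a A \<le> ereal r \<longleftrightarrow> (\<exists>s. sum s A \<le> r \<and> (\<forall>i\<in>A. a i \<le> ereal (s i)))"
proof
  assume le: "sum a A \<le> ereal r"
  have "a i \<noteq> \<infinity>" if "i \<in> A" for i
    using le sum_Pinfty[of a A] that assms(1) by auto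
  then have fin: "a i = ereal (real_of_ereal (a i))" if "i \<in> A" for i
    using that assms(2) by (auto simp: ereal_real)
  then have "sum a A = ereal (\<Sum>i\<in>A. real_of_ereal (a i))"
    by (simp add: sum_ereal[symmetric] cong: sum.cong)
  then show "\<exists>s. sum s A \<le> r \<and> (\<forall>i\<in>A. a i \<le> ereal (s i))"
    using le fin by (intro exI[of _ "\<lambda>i. real_of_ereal (a i)"]) auto
next
  assume "\<exists>s. sum s A \<le> r \<and> (\<forall>i\<in>A. a i \<le> ereal (s i))"
  then obtain s where s: "sum s A \<le> r" "\<forall>i\<in>A. a i \<le> ereal (s i)" by blast
  then have "sum a A \<le> (\<Sum>i\<in>A. ereal (s i))" by (intro sum_mono) auto
  also have "\<dots> \<le> ereal r" using s(1) by simp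
  finally show "sum a A \<le> ereal r" .
qed

locale robust_problem =
  fixes L :: nat
    and c :: "nat \<Rightarrow> 'z::euclidean_space \<Rightarrow> ereal"
    and f :: "'n::finite \<Rightarrow> 'x::euclidean_space \<Rightarrow> 'z \<Rightarrow> real"
    and o\<^sub>0 :: 'n
  assumes unc_nonempty: "unc_set L c \<noteq> {}"
    and constr: "\<And>l. l \<in> {1..L} \<Longrightarrow> proper_fun (c l) \<and> closed_fun (c l) \<and> convex_fun (c l)"
    and f_convex: "\<And>i z. convex_on UNIV (\<lambda>x. f i x z)"
    and f_concave: "\<And>i x. convex_on UNIV (\<lambda>z. - f i x z)"
begin

abbreviation "Z \<equiv> unc_set L c"
abbreviation "fe \<equiv> \<lambda>i x z. ereal (f i x z)"
abbreviation "obj \<equiv> DB_obj fe o\<^sub>0"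

text \<open>
  The Lagrangian. Fixing the multiplier of the objective to \<open>1\<close> treats all indices alike; this
  replaces the entry \<open>0\<close> that the dual problem prescribes.
\<close>

definition lagr :: "'x \<Rightarrow> ('z ^ 'n) \<times> (real ^ 'n) \<Rightarrow> real" where
  "lagr x = (\<lambda>(z, l). \<Sum>i\<in>UNIV. l $ i * f i x (z $ i))"

definition mult_set :: "(('z ^ 'n) \<times> (real ^ 'n)) set" where
  "mult_set = {(z, l). (\<forall>i. z $ i \<in> Z \<and> 0 \<le> l $ i) \<and> l $ o\<^sub>0 = 1}"

definition unit_mult :: "real ^ 'n \<Rightarrow> real ^ 'n" where
  "unit_mult l = (\<chi> i. if i = o\<^sub>0 then 1 else l $ i)"

lemma unit_mult_nth: "unit_mult l $ i = (if i = o\<^sub>0 then 1 else l $ i)"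
  by (simp add: unit_mult_def)

lemma unc_set_convex: "convex Z"
proof -
  have "Z = (\<Inter>l\<in>{1..L}. {z. c l z \<le> ereal 0})" by (auto simp: unc_set_def zero_ereal_def)
  moreover have "convex {z. c l z \<le> ereal 0}" if "l \<in> {1..L}" for l
    using constr[OF that] by (intro convex_sublevel) simp
  ultimately show ?thesis by (auto intro: convex_INT)
qed

lemma unc_set_closed: "closed Z"
proof -
  have "Z = (\<Inter>l\<in>{1..L}. {z. c l z \<le> 0})" by (auto simp: unc_set_def)
  then show ?thesis using constr by (auto intro!: closed_INT closed_sublevel simp: closed_fun_def)
qed

lemma f_convex_mult: "0 \<le> k \<Longrightarrow> convex_on UNIV (\<lambda>x. k * f i x z)"
  by (rule convex_on_cmul[OF _ f_convex])

text \<open>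
  The multipliers enter bilinearly with the uncertain parameters; averaging the products
  \<open>l\<^sub>i z\<^sub>i\<close> instead of the \<open>z\<^sub>i\<close> restores concavity.
\<close>

sublocale convex_concavelike lagr mult_set
proof
  obtain z where "z \<in> Z" using unc_nonempty by blast
  then have "((\<chi> i. z), axis o\<^sub>0 1) \<in> mult_set"
    by (auto simp: mult_set_def axis_def)
  then show "mult_set \<noteq> {}" by blast
next
  fix y assume "y \<in> mult_set"
  then obtain z l where y: "y = (z, l)" "\<And>i. 0 \<le> l $ i" by (auto simp: mult_set_def)
  have "convex_on UNIV (\<lambda>x. \<Sum>i\<in>A. l $ i * f i x (z $ i))" if "finite A" for A
    using that
  proof (induction A rule: finite_induct)
    case empty
    then show ?case by (simp add: convex_on_def)
  next
    case (insert i A)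
    then show ?case using f_convex_mult[OF y(2)] by (simp add: convex_on_add)
  qed
  then show "convex_on UNIV (\<lambda>x. lagr x y)" by (simp add: lagr_def y(1))
next
  fix y1 y2 and t :: real
  assume y1: "y1 \<in> mult_set" and y2: "y2 \<in> mult_set" and t: "0 \<le> t" "t \<le> 1"
  obtain z1 l1 where 1: "y1 = (z1, l1)" "\<And>i. z1 $ i \<in> Z" "\<And>i. 0 \<le> l1 $ i" "l1 $ o\<^sub>0 = 1"
    using y1 by (auto simp: mult_set_def)
  obtain z2 l2 where 2: "y2 = (z2, l2)" "\<And>i. z2 $ i \<in> Z" "\<And>i. 0 \<le> l2 $ i" "l2 $ o\<^sub>0 = 1"
    using y2 by (auto simp: mult_set_def)
  define l where "l = (1 - t) *\<^sub>R l1 + t *\<^sub>R l2"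
  \<comment> \<open>The weight is chosen so that \<open>l $ i *\<^sub>R z $ i\<close> is the average
    of the two products. If \<open>l $ i = 0\<close>, division by zero gives weight
    \<open>0\<close>, which is harmless since both averaged multipliers vanish.\<close>
  define \<beta> where "\<beta> i = t * l2 $ i / l $ i" for i
  define z where "z = (\<chi> i. (1 - \<beta> i) *\<^sub>R z1 $ i + \<beta> i *\<^sub>R z2 $ i)"
  have nonneg: "0 \<le> (1 - t) * l1 $ i" "0 \<le> t * l2 $ i" for i
    using 1 2 t by simp_all
  have l: "l $ i = (1 - t) * l1 $ i + t * l2 $ i" for i by (simp add: l_def)
  have l0: "0 \<le> l $ i" for i using nonneg[of i] l[of i] by linarith
  have \<beta>: "0 \<le> \<beta> i" "\<beta> i \<le> 1" for i
    unfolding \<beta>_def using nonneg[of i] l[of i] by (auto simp: divide_le_eq_1)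
  have \<beta>l: "\<beta> i * l $ i = t * l2 $ i" "(1 - \<beta> i) * l $ i = (1 - t) * l1 $ i" for i
  proof -
    show *: "\<beta> i * l $ i = t * l2 $ i"
    proof (cases "l $ i = 0")
      case True
      then have "t * l2 $ i = 0" using nonneg[of i] l[of i] by linarith
      then show ?thesis using True by simp
    qed (simp add: \<beta>_def)
    show "(1 - \<beta> i) * l $ i = (1 - t) * l1 $ i"
      using * l[of i] by (simp add: left_diff_distrib)
  qed
  have "z $ i \<in> Z" for i
    unfolding z_def using convexD[OF unc_set_convex 1(2) 2(2), of "1 - \<beta> i" "\<beta> i" i i] \<beta>[of i] by simp
  then have "(z, l) \<in> mult_set"
    using l0 1(4) 2(4) by (auto simp: mult_set_def l)
  moreover have "(1 - t) * lagr x y1 + t * lagr x y2 \<le> lagr x (z, l)" for x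
  proof -
    have "(1 - t) * (l1 $ i * f i x (z1 $ i)) + t * (l2 $ i * f i x (z2 $ i)) \<le> l $ i * f i x (z $ i)" for i
    proof -
      have "(1 - t) * (l1 $ i * f i x (z1 $ i)) + t * (l2 $ i * f i x (z2 $ i))
          = (1 - \<beta> i) * l $ i * f i x (z1 $ i) + \<beta> i * l $ i * f i x (z2 $ i)"
        unfolding \<beta>l by (simp add: mult.assoc)
      also have "\<dots> = l $ i * ((1 - \<beta> i) * f i x (z1 $ i) + \<beta> i * f i x (z2 $ i))"
        by (simp add: algebra_simps)
      also have "\<dots> \<le> l $ i * f i x (z $ i)"
        using convex_onD[OF f_concave[of i x] \<beta>[of i], of "z1 $ i" "z2 $ i"] l0[of i]
        by (intro mult_left_mono) (simp_all add: z_def)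
      finally show ?thesis .
    qed
    then show ?thesis
      by (simp add: lagr_def 1(1) 2(1) sum_distrib_left flip: sum.distrib) (intro sum_mono, simp)
  qed
  ultimately show "\<exists>y\<in>mult_set. \<forall>x. (1 - t) * lagr x y1 + t * lagr x y2 \<le> lagr x y" by blast
qed

text \<open>Maximizing over the multipliers penalizes violated constraints without limit: zero
  multipliers isolate the objective, and a large single multiplier detects a violation.\<close>

lemma lagr_le_iff:
  "(\<forall>y\<in>mult_set. lagr x y \<le> v) \<longleftrightarrow>
     x \<in> constr_set (PW_ineqs fe Z o\<^sub>0) {} \<and> PW_fun fe Z o\<^sub>0 x \<le> ereal v"
proof -
  have "(\<forall>y\<in>mult_set. lagr x y \<le> v) \<longleftrightarrow>
      (\<forall>z\<in>Z. f o\<^sub>0 x z \<le> v) \<and> (\<forall>i. i \<noteq> o\<^sub>0 \<longrightarrow> (\<forall>z\<in>Z. f i x z \<le> 0))" (is "?l \<longleftrightarrow> ?r")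
  proof (intro iffI conjI allI impI ballI)
    fix z assume l: ?l and z: "z \<in> Z"
    \<comment> \<open>One and the same \<open>z\<close> is used for all indices.\<close>
    have *: "f o\<^sub>0 x z + (\<Sum>i\<in>-{o\<^sub>0}. k i * f i x z) \<le> v" if "\<And>i. 0 \<le> k i" for k
    proof -
      have "((\<chi> i. z), unit_mult (\<chi> i. k i)) \<in> mult_set"
        using z that by (auto simp: mult_set_def unit_mult_nth)
      moreover have "lagr x ((\<chi> i. z), unit_mult (\<chi> i. k i)) = f o\<^sub>0 x z + (\<Sum>i\<in>-{o\<^sub>0}. k i * f i x z)"
        unfolding lagr_def by (simp add: unit_mult_nth sum.remove[of UNIV o\<^sub>0] Compl_eq_Diff_UNIV)
      ultimately show ?thesis using l by force
    qed
    show fv: "f o\<^sub>0 x z \<le> v" using *[of "\<lambda>_. 0"] by simp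
    fix j assume j: "j \<noteq> o\<^sub>0"
    show "f j x z \<le> 0"
    proof (rule ccontr)
      assume pos: "\<not> f j x z \<le> 0"
      \<comment> \<open>With this multiplier the objective plus the penalty equals
        \<open>v + 1\<close>.\<close>
      define t where "t = (v - f o\<^sub>0 x z + 1) / f j x z"
      have "0 \<le> t" using fv pos by (simp add: t_def)
      then have "f o\<^sub>0 x z + (\<Sum>i\<in>-{o\<^sub>0}. (if i = j then t else 0) * f i x z) \<le> v"
        by (intro *) simp
      moreover have "(\<Sum>i\<in>-{o\<^sub>0}. (if i = j then t else 0) * f i x z) = t * f j x z"
        using j by (simp add: if_distrib[of "\<lambda>a. a * _"] cong: if_cong)
      ultimately show False using pos by (simp add: t_def)
    qed
  next
    fix y assume r: ?r and "y \<in> mult_set"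
    then obtain z l where y: "y = (z, l)" "\<And>i. z $ i \<in> Z" "\<And>i. 0 \<le> l $ i" "l $ o\<^sub>0 = 1"
      by (auto simp: mult_set_def)
    have "lagr x y \<le> (\<Sum>i\<in>UNIV. if i = o\<^sub>0 then v else 0)"
      unfolding lagr_def y(1) prod.case
      using r y by (intro sum_mono) (auto simp: mult_nonneg_nonpos)
    then show "lagr x y \<le> v" by simp
  qed
  then show ?thesis
    by (auto simp: constr_set_PW PW_fun_def SUP_le_iff)
qed

section \<open>Conjugates, perspectives and the dual objective in terms of real bounds\<close>

lemma conj1_le_iff: "conj1 (fe i) w z \<le> ereal s \<longleftrightarrow> (\<forall>x. w \<bullet> x - f i x z \<le> s)"
  by (simp add: conj1_def SUP_le_iff)

lemma conj1_gt_MInf: "- \<infinity> < conj1 (fe i) w z"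
  using SUP_upper[of 0 UNIV "\<lambda>x. ereal (w \<bullet> x) - fe i x z"]
  by (auto simp: conj1_def intro: less_le_trans[rotated])

text \<open>The biconjugate lies below the finite function \<open>fe i\<close>. Hence for multiplier
  \<open>0\<close> the support function in \<open>persp1\<close> is that of the whole space, which
  is \<open>0\<close> at the origin and infinite elsewhere.\<close>

lemma edom_biconjugate: "edom (\<lambda>x. conj1 (conj1 (fe i)) x z) = UNIV"
proof -
  have "conj1 (conj1 (fe i)) x z \<le> fe i x z" for x
    unfolding conj1_def[of "conj1 (fe i)"]
  proof (rule SUP_least)
    fix w
    have "ereal (w \<bullet> x) - fe i x z \<le> conj1 (fe i) w z"
      unfolding conj1_def by (rule SUP_upper) simp
    then show "ereal (x \<bullet> w) - conj1 (fe i) w z \<le> fe i x z"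
      by (cases "conj1 (fe i) w z") (auto simp: inner_commute)
  qed
  then have "conj1 (conj1 (fe i)) x z < \<infinity>" for x
    using le_less_trans by fastforce
  then show ?thesis by (simp add: edom_def)
qed

text \<open>For every nonnegative \<open>l\<close> the perspective is the conjugate of the scaled
  function \<open>l * f i\<close>; at \<open>l = 0\<close> this is the conjugate of the zero
  function. No later argument has to distinguish these cases.\<close>

lemma persp1_le_iff:
  "persp1 (conj1 (fe i)) l w z \<le> ereal s \<longleftrightarrow> 0 \<le> l \<and> (\<forall>x. w \<bullet> x - l * f i x z \<le> s)"
proof -
  consider "l > 0" | "l = 0" | "l < 0" by linarith
  then show ?thesis
  proof cases
    case 1
    have "persp1 (conj1 (fe i)) l w z \<le> ereal s \<longleftrightarrow> conj1 (fe i) (w /\<^sub>R l) z \<le> ereal (s / l)"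
      using 1 by (cases "conj1 (fe i) (w /\<^sub>R l) z") (auto simp: persp1_def field_simps)
    also have "\<dots> \<longleftrightarrow> (\<forall>x. w \<bullet> x - l * f i x z \<le> s)"
    proof -
      have "(w /\<^sub>R l) \<bullet> x - f i x z = (w \<bullet> x - l * f i x z) / l" for x
        using 1 by (simp add: divide_inverse algebra_simps)
      then show ?thesis unfolding conj1_le_iff using 1 by (simp add: divide_le_cancel)
    qed
    finally show ?thesis using 1 by simp
  next
    case 2
    then show ?thesis
      by (simp add: persp1_def edom_biconjugate support_fun_def SUP_le_iff inner_commute)
  next
    case 3
    then show ?thesis by (simp add: persp1_def)
  qed
qed

lemma persp1_gt_MInf: "- \<infinity> < persp1 (conj1 (fe i)) l w z"
proof (rule ccontr)
  assume "\<not> - \<infinity> < persp1 (conj1 (fe i)) l w z"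
  then have "persp1 (conj1 (fe i)) l w z \<le> ereal s" for s by simp
  then have "w \<bullet> 0 - l * f i 0 z \<le> s" for s unfolding persp1_le_iff by blast
  from this[of "w \<bullet> 0 - l * f i 0 z - 1"] show False by simp
qed

text \<open>Minus the dual objective is a sum of conjugates of scaled functions.
  \<open>unit_mult\<close> lets the objective term be treated like the constraint terms, and
  \<open>s\<close> collects real bounds on all of them.\<close>

lemma obj_ge_iff:
  "ereal (- r) \<le> obj (w, z, l) \<longleftrightarrow> (\<forall>i. i \<noteq> o\<^sub>0 \<longrightarrow> 0 \<le> l $ i) \<and>
     (\<exists>s. sum s UNIV \<le> r \<and> (\<forall>i x. w $ i \<bullet> x - unit_mult l $ i * f i x (z $ i) \<le> s i))"
proof -
  define a where "a i = (if i = o\<^sub>0 then conj1 (fe i) (w $ i) (z $ i)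
    else persp1 (conj1 (fe i)) (l $ i) (w $ i) (z $ i))" for i
  have a: "a i \<noteq> - \<infinity>" for i
    using conj1_gt_MInf[of i "w $ i" "z $ i"] persp1_gt_MInf[of i "l $ i" "w $ i" "z $ i"]
    by (auto simp: a_def)
  have "sum a UNIV = a o\<^sub>0 + sum a (- {o\<^sub>0})"
    by (simp add: sum.remove[of UNIV o\<^sub>0] Compl_eq_Diff_UNIV)
  moreover have "obj (w, z, l) = - a o\<^sub>0 - sum a (- {o\<^sub>0})"
    by (auto simp: DB_obj_def a_def intro!: arg_cong2[of _ _ _ _ minus] sum.cong)
  moreover have "sum a (- {o\<^sub>0}) \<noteq> - \<infinity>" using a by (rule sum_neq_MInf)
  \<comment> \<open>Neither term is minus infinity, so negating both separately agrees with negating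
    their sum.\<close>
  ultimately have "ereal (- r) \<le> obj (w, z, l) \<longleftrightarrow> sum a UNIV \<le> ereal r"
    using a[of o\<^sub>0] by (cases "a o\<^sub>0"; cases "sum a (- {o\<^sub>0})") auto
  also have "\<dots> \<longleftrightarrow> (\<exists>s. sum s UNIV \<le> r \<and> (\<forall>i. a i \<le> ereal (s i)))"
    using sum_ereal_le_iff[of UNIV a r] a by simp
  also have "\<dots> \<longleftrightarrow> (\<forall>i. i \<noteq> o\<^sub>0 \<longrightarrow> 0 \<le> l $ i) \<and>
     (\<exists>s. sum s UNIV \<le> r \<and> (\<forall>i x. w $ i \<bullet> x - unit_mult l $ i * f i x (z $ i) \<le> s i))"
  proof -
    have "a i \<le> ereal (t) \<longleftrightarrow> (i \<noteq> o\<^sub>0 \<longrightarrow> 0 \<le> l $ i) \<and>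
        (\<forall>x. w $ i \<bullet> x - unit_mult l $ i * f i x (z $ i) \<le> t)" for i t
      by (simp add: a_def conj1_le_iff persp1_le_iff unit_mult_nth)
    then show ?thesis by auto
  qed
  finally show ?thesis .
qed

text \<open>
  Fenchel duality for the sum \<open>lagr\<close>: for fixed \<open>(z, l)\<close>, its conjugate is the exact infimal
  convolution of the conjugates of the summands.
\<close>

lemma conj_epi_iff:
  "(u, r) \<in> conj_epi \<longleftrightarrow> (\<exists>w z l. (\<Sum>i\<in>UNIV. w $ i) = u \<and> (\<forall>i. z $ i \<in> Z) \<and>
     (\<forall>i. i \<noteq> o\<^sub>0 \<longrightarrow> 0 \<le> l $ i) \<and> l $ o\<^sub>0 = 0 \<and> ereal (- r) \<le> obj (w, z, l))"
proof
  assume "(u, r) \<in> conj_epi"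
  then obtain y where "y \<in> mult_set" and y: "\<And>x. u \<bullet> x - lagr x y \<le> r"
    by (auto simp: conj_epi_def)
  then obtain z l where zl: "\<And>i. z $ i \<in> Z" "\<And>i. 0 \<le> l $ i" "l $ o\<^sub>0 = 1" and "y = (z, l)"
    by (auto simp: mult_set_def)
  then have le: "u \<bullet> x - (\<Sum>i\<in>UNIV. l $ i * f i x (z $ i)) \<le> r" for x
    using y[of x] by (simp add: lagr_def)
  obtain w :: "'x ^ 'n" and s where w: "(\<Sum>i\<in>UNIV. w $ i) = u" "sum s UNIV \<le> r"
    "\<And>i x. w $ i \<bullet> x - l $ i * f i x (z $ i) \<le> s i"
    using conjugate_sum_split[of "\<lambda>i x. l $ i * f i x (z $ i)" u r] f_convex_mult zl(2) le by blast
  \<comment> \<open>The dual constraints want entry \<open>0\<close> at \<open>o\<^sub>0\<close>;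
    \<open>unit_mult\<close> restores the \<open>1\<close>.\<close>
  define l' where "l' = (\<chi> i. if i = o\<^sub>0 then 0 else l $ i)"
  have "unit_mult l' $ i = l $ i" for i by (simp add: unit_mult_nth l'_def zl)
  then have "ereal (- r) \<le> obj (w, z, l')"
    unfolding obj_ge_iff using w zl by (auto simp: l'_def)
  moreover have "\<forall>i. i \<noteq> o\<^sub>0 \<longrightarrow> 0 \<le> l' $ i" "l' $ o\<^sub>0 = 0" by (simp_all add: l'_def zl)
  ultimately show "\<exists>w z l. (\<Sum>i\<in>UNIV. w $ i) = u \<and> (\<forall>i. z $ i \<in> Z) \<and>
     (\<forall>i. i \<noteq> o\<^sub>0 \<longrightarrow> 0 \<le> l $ i) \<and> l $ o\<^sub>0 = 0 \<and> ereal (- r) \<le> obj (w, z, l)"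
    using w(1) zl(1) by blast
next
  assume "\<exists>w z l. (\<Sum>i\<in>UNIV. w $ i) = u \<and> (\<forall>i. z $ i \<in> Z) \<and>
     (\<forall>i. i \<noteq> o\<^sub>0 \<longrightarrow> 0 \<le> l $ i) \<and> l $ o\<^sub>0 = 0 \<and> ereal (- r) \<le> obj (w, z, l)"
  then obtain w z l s where w: "(\<Sum>i\<in>UNIV. w $ i) = u" "\<And>i. z $ i \<in> Z" "\<And>i. i \<noteq> o\<^sub>0 \<Longrightarrow> 0 \<le> l $ i"
    and s: "sum s UNIV \<le> r" "\<And>i x. w $ i \<bullet> x - unit_mult l $ i * f i x (z $ i) \<le> s i"
    unfolding obj_ge_iff by auto
  have "(z, unit_mult l) \<in> mult_set"
    using w by (auto simp: mult_set_def unit_mult_nth)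
  moreover have "u \<bullet> x - lagr x (z, unit_mult l) \<le> r" for x
  proof -
    have "u \<bullet> x - lagr x (z, unit_mult l) = (\<Sum>i\<in>UNIV. w $ i \<bullet> x - unit_mult l $ i * f i x (z $ i))"
      by (simp add: lagr_def sum_subtractf inner_sum_left flip: w(1))
    also have "\<dots> \<le> sum s UNIV" using s(2) by (rule sum_mono)
    finally show ?thesis using s(1) by simp
  qed
  ultimately show "(u, r) \<in> conj_epi" by (auto simp: conj_epi_def)
qed

lemma constr_set_iff:
  "(w, z, l) \<in> constr_set (DB_ineqs L c o\<^sub>0) (DB_eqs o\<^sub>0) \<longleftrightarrow>
     (\<Sum>i\<in>UNIV. w $ i) = (0::'x) \<and> (\<forall>i. z $ i \<in> Z) \<and>
     (\<forall>i. i \<noteq> o\<^sub>0 \<longrightarrow> 0 \<le> l $ i) \<and> l $ o\<^sub>0 = 0"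
  by (rule constr_set_DB)

section \<open>Weak duality, and strong duality under the relative interior condition\<close>

abbreviation "pval \<equiv> val_min (PW_fun fe Z o\<^sub>0) (PW_ineqs fe Z o\<^sub>0) {}"
abbreviation "dval \<equiv> val_max obj (DB_ineqs L c o\<^sub>0) (DB_eqs o\<^sub>0)"

text \<open>Both sides express that \<open>(0, - r)\<close> lies in \<open>conj_epi\<close>.\<close>

lemma dual_feasible_iff:
  "(\<exists>y\<in>mult_set. \<forall>x. r \<le> lagr x y) \<longleftrightarrow>
     (\<exists>d\<in>constr_set (DB_ineqs L c o\<^sub>0) (DB_eqs o\<^sub>0). ereal r \<le> obj d)"
proof -
  have "(\<exists>y\<in>mult_set. \<forall>x. r \<le> lagr x y) \<longleftrightarrow> (0, - r) \<in> conj_epi"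
    by (simp add: conj_epi_def)
  then show ?thesis by (auto simp: conj_epi_iff Bex_def constr_set_iff)
qed

lemma weak_duality:
  assumes x: "x \<in> constr_set (PW_ineqs fe Z o\<^sub>0) {}"
  shows "dval \<le> PW_fun fe Z o\<^sub>0 x"
  unfolding val_max_def
proof (rule SUP_least)
  fix d :: "('x, 'z, 'n) dual" assume d: "d \<in> constr_set (DB_ineqs L c o\<^sub>0) (DB_eqs o\<^sub>0)"
  show "obj d \<le> PW_fun fe Z o\<^sub>0 x"
  proof (rule ccontr)
    assume "\<not> obj d \<le> PW_fun fe Z o\<^sub>0 x"
    \<comment> \<open>The characterizations of both problems by the Lagrangian take real bounds
      only, so a gap between possibly infinite values is tested with two reals
      \<open>v < r\<close>.\<close>
    then obtain r where r: "PW_fun fe Z o\<^sub>0 x < ereal r" "ereal r < obj d"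
      using ereal_dense2 by (meson not_le)
    then obtain v where v: "PW_fun fe Z o\<^sub>0 x < ereal v" "ereal v < ereal r"
      using ereal_dense2 by blast
    obtain y where y: "y \<in> mult_set" "r \<le> lagr x y"
      using d r(2) dual_feasible_iff[of r] less_imp_le by blast
    have "lagr x y \<le> v"
      using lagr_le_iff[of x v] x v(1) y(1) less_imp_le by blast
    then show False using y(2) v(2) by simp
  qed
qed

lemma weak_duality_val: "dval \<le> pval"
  unfolding val_min_def using weak_duality by (rule INF_greatest)

text \<open>The condition makes the dual feasible. If the dual value is infinite, weak duality makes
  the primal infeasible, hence solvable by convention; otherwise \<open>primal_attained\<close>
  applies with the real dual value.\<close>

lemma strong_duality_primal_attained:
  assumes ri: "0 \<in> rel_interior (fst ` conj_epi)"
  shows "pval = dval" "solvable_min (PW_fun fe Z o\<^sub>0) (PW_ineqs fe Z o\<^sub>0) {}"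
proof -
  have "0 \<in> fst ` conj_epi" using ri rel_interior_subset by blast
  then obtain r where "(0, r) \<in> conj_epi" by auto
  then have "\<exists>y\<in>mult_set. \<forall>x. - r \<le> lagr x y" by (simp add: conj_epi_def minus_le_iff)
  then obtain d where "d \<in> constr_set (DB_ineqs L c o\<^sub>0) (DB_eqs o\<^sub>0)" "ereal (- r) \<le> obj d"
    unfolding dual_feasible_iff by blast
  then have gt: "ereal (- r) \<le> dval" unfolding val_max_def by (meson SUP_upper order_trans)
  have "pval = dval \<and> solvable_min (PW_fun fe Z o\<^sub>0) (PW_ineqs fe Z o\<^sub>0) {}"
  proof (cases "dval = \<infinity>")
    case True
    then have "PW_fun fe Z o\<^sub>0 x = \<infinity>" if "x \<in> constr_set (PW_ineqs fe Z o\<^sub>0) {}" for x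
      using weak_duality[OF that] by simp
    then show ?thesis
      using weak_duality_val True by (auto simp: solvable_min_def feasible_min_def)
  next
    case False
    then obtain v where v: "dval = ereal v" using gt by (cases dval) auto
    have "r \<le> v" if y: "y \<in> mult_set" "\<And>x. r \<le> lagr x y" for y r
    proof -
      obtain d where "d \<in> constr_set (DB_ineqs L c o\<^sub>0) (DB_eqs o\<^sub>0)" "ereal r \<le> obj d"
        using dual_feasible_iff[of r] y by blast
      then have "ereal r \<le> dval" unfolding val_max_def by (meson SUP_upper order_trans)
      then show ?thesis using v by simp
    qed
    then obtain x where "\<And>y. y \<in> mult_set \<Longrightarrow> lagr x y \<le> v"
      using primal_attained[OF ri] by blast
    then have x: "x \<in> constr_set (PW_ineqs fe Z o\<^sub>0) {}" "PW_fun fe Z o\<^sub>0 x \<le> dval"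
      using lagr_le_iff[of x v] v by auto
    then have "pval \<le> PW_fun fe Z o\<^sub>0 x" unfolding val_min_def by (intro INF_lower)
    then have "pval = dval" "PW_fun fe Z o\<^sub>0 x = pval" using x(2) weak_duality_val by auto
    then show ?thesis using x(1) v by (auto simp: solvable_min_def feasible_min_def)
  qed
  then show "pval = dval" "solvable_min (PW_fun fe Z o\<^sub>0) (PW_ineqs fe Z o\<^sub>0) {}" by auto
qed

subsection \<open>Bounded feasible region\<close>

text \<open>A recession direction preserves every upper bound on the Lagrangian, so by
  \<open>lagr_le_iff\<close> it yields a ray of feasible points.\<close>

lemma bounded_feasible_imp_rel_interior:
  assumes ne: "feasible_min (PW_fun fe Z o\<^sub>0) (PW_ineqs fe Z o\<^sub>0) {} \<noteq> {}"
    and bdd: "bounded (feasible_min (PW_fun fe Z o\<^sub>0) (PW_ineqs fe Z o\<^sub>0) {})"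
  shows "0 \<in> rel_interior (fst ` conj_epi)"
proof (rule ccontr)
  assume "0 \<notin> rel_interior (fst ` conj_epi)"
  then obtain a where a: "a \<noteq> 0"
    and rec: "\<And>x y t. y \<in> mult_set \<Longrightarrow> 0 \<le> t \<Longrightarrow> lagr (x - t *\<^sub>R a) y \<le> lagr x y"
    using recession_direction by blast
  obtain x where x: "x \<in> constr_set (PW_ineqs fe Z o\<^sub>0) {}" "PW_fun fe Z o\<^sub>0 x \<noteq> \<infinity>"
    using ne by (auto simp: feasible_min_def)
  then obtain v where "PW_fun fe Z o\<^sub>0 x \<le> ereal v" by (cases "PW_fun fe Z o\<^sub>0 x") auto
  then have v: "\<forall>y\<in>mult_set. lagr x y \<le> v" using lagr_le_iff[of x v] x by blast
  have feas: "x - t *\<^sub>R a \<in> feasible_min (PW_fun fe Z o\<^sub>0) (PW_ineqs fe Z o\<^sub>0) {}" if "0 \<le> t" for t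
  proof -
    have "\<forall>y\<in>mult_set. lagr (x - t *\<^sub>R a) y \<le> v" using rec[OF _ that, of _ x] v by force
    then show ?thesis
      using lagr_le_iff[of "x - t *\<^sub>R a" v] by (auto simp: feasible_min_def)
  qed
  obtain B where B: "\<And>p. p \<in> feasible_min (PW_fun fe Z o\<^sub>0) (PW_ineqs fe Z o\<^sub>0) {} \<Longrightarrow> norm p \<le> B"
    using bdd by (auto simp: bounded_iff)
  \<comment> \<open>This gives \<open>t *\<^sub>R a\<close> the norm \<open>B + norm x + 1\<close>,
    more than the triangle inequality allows.\<close>
  define t where "t = (B + norm x + 1) / norm a"
  have "norm x \<le> B" using B[OF feas[of 0]] by simp
  then have t: "0 \<le> t" using order_trans[OF norm_ge_zero] by (fastforce simp: t_def)
  have "norm (t *\<^sub>R a) \<le> norm x + norm (x - t *\<^sub>R a)"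
    using norm_triangle_ineq4[of x "x - t *\<^sub>R a"] by simp
  also have "\<dots> \<le> norm x + B" using B[OF feas[OF t]] by simp
  finally show False using t a by (simp add: t_def)
qed

subsection \<open>Slater points of the primal problem\<close>

lemma f_isCont: "isCont (f i x) z"
proof -
  have "continuous_on UNIV (\<lambda>z. - (- f i x z))"
    by (intro continuous_on_minus convex_on_continuous f_concave) auto
  then show ?thesis by (simp add: continuous_on_eq_continuous_at)
qed

lemma lagr_tendsto:
  assumes "(z \<longlongrightarrow> z0) F" "(l \<longlongrightarrow> l0) F"
  shows "((\<lambda>k. lagr x (z k, l k)) \<longlongrightarrow> lagr x (z0, l0)) F"
  unfolding lagr_def prod.case
  using assms by (intro tendsto_sum tendsto_mult isCont_tendsto_compose[OF f_isCont] tendsto_vec_nth)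

lemma bounded_vec:
  fixes A :: "'a::real_normed_vector set"
  assumes "bounded A"
  shows "bounded {v :: 'a ^ 'n. \<forall>i. v $ i \<in> A}"
proof -
  obtain B where B: "\<And>a. a \<in> A \<Longrightarrow> norm a \<le> B" using assms by (auto simp: bounded_iff)
  have "norm v \<le> (\<Sum>i\<in>(UNIV::'n set). B)" if "\<forall>i. v $ i \<in> A" for v :: "'a ^ 'n"
    unfolding norm_vec_def
    by (rule order_trans[OF L2_set_le_sum sum_mono]) (use B that in auto)
  then show ?thesis by (intro boundedI[of _ "\<Sum>i\<in>(UNIV::'n set). B"]) auto
qed

text \<open>The Slater point bounds the multipliers of any bounded part of \<open>conj_epi\<close>.\<close>

lemma closed_conj_epi:
  assumes bdd: "bounded Z" and \<delta>: "\<delta> > 0"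
    and M: "\<And>z. z \<in> Z \<Longrightarrow> f o\<^sub>0 x0 z \<le> M"
    and slater: "\<And>i z. i \<noteq> o\<^sub>0 \<Longrightarrow> z \<in> Z \<Longrightarrow> f i x0 z \<le> - \<delta>"
  shows "closed conj_epi"
  unfolding closed_sequential_limits
proof (intro allI impI, elim conjE)
  fix e e0 assume e: "\<forall>k. e k \<in> conj_epi" and lim: "e \<longlonglongrightarrow> e0"
  define u where "u = fst \<circ> e"
  define r where "r = snd \<circ> e"
  have "\<forall>k. \<exists>z l. (z, l) \<in> mult_set \<and> (\<forall>x. u k \<bullet> x - lagr x (z, l) \<le> r k)"
  proof
    fix k
    have "(u k, r k) \<in> conj_epi" using e by (simp add: u_def r_def)
    then show "\<exists>z l. (z, l) \<in> mult_set \<and> (\<forall>x. u k \<bullet> x - lagr x (z, l) \<le> r k)"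
      by (fastforce simp: conj_epi_def)
  qed
  then obtain z l where zl: "\<And>k. (z k, l k) \<in> mult_set"
    and le: "\<And>k x. u k \<bullet> x - lagr x (z k, l k) \<le> r k" by metis
  have zZ: "z k $ i \<in> Z" and l0: "0 \<le> l k $ i" and l1: "l k $ o\<^sub>0 = 1" for k i
    using zl[of k] by (auto simp: mult_set_def)
  have ulim: "u \<longlonglongrightarrow> fst e0" and rlim: "r \<longlonglongrightarrow> snd e0"
    unfolding u_def r_def using lim by (auto simp: o_def intro: tendsto_fst tendsto_snd)
  have "(\<lambda>k. r k - u k \<bullet> x0 + M) \<longlonglongrightarrow> snd e0 - fst e0 \<bullet> x0 + M"
    by (intro tendsto_intros ulim rlim)
  then have "bounded (range (\<lambda>k. r k - u k \<bullet> x0 + M))"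
    by (rule convergent_imp_bounded)
  then obtain B where "\<And>k. \<bar>r k - u k \<bullet> x0 + M\<bar> \<le> B"
    by (auto simp: bounded_iff)
  then have B: "r k - u k \<bullet> x0 + M \<le> B" for k by (meson abs_le_D1)
  \<comment> \<open>At \<open>x0\<close> every constraint term is nonpositive and the
    \<open>i\<close>-th is at most \<open>- \<delta> * l k $ i\<close>, so membership in
    \<open>conj_epi\<close> bounds this multiplier by \<open>B / \<delta>\<close>. The
    \<open>1\<close> in the maximum covers the entry at \<open>o\<^sub>0\<close>.\<close>
  have l_le: "l k $ i \<le> max 1 (B / \<delta>)" for k i
  proof (cases "i = o\<^sub>0")
    case True
    then show ?thesis using l1 by simp
  next
    case False
    have "lagr x0 (z k, l k) \<le> (\<Sum>j\<in>UNIV. (if j = o\<^sub>0 then M else 0) + (if j = i then - (\<delta> * l k $ i) else 0))"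
      unfolding lagr_def prod.case
    proof (rule sum_mono)
      fix j
      show "l k $ j * f j x0 (z k $ j) \<le> (if j = o\<^sub>0 then M else 0) + (if j = i then - (\<delta> * l k $ i) else 0)"
      proof (cases "j = o\<^sub>0")
        case True
        then show ?thesis using M[OF zZ] l1 False by simp
      next
        case j: False
        then have "l k $ j * f j x0 (z k $ j) \<le> l k $ j * (- \<delta>)"
          using slater zZ l0 by (intro mult_left_mono) auto
        moreover have "l k $ j * (- \<delta>) \<le> 0" using l0[of k j] \<delta> by simp
        ultimately show ?thesis using j by (auto simp: mult.commute)
      qed
    qed
    also have "\<dots> = M - \<delta> * l k $ i" by (simp add: sum.distrib)
    finally have "\<delta> * l k $ i \<le> B" using le[of k x0] B[of k] by linarith
    then have "l k $ i \<le> B / \<delta>" using \<delta> by (simp add: field_simps)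
    then show ?thesis by simp
  qed
  let ?K = "{v :: 'z ^ 'n. \<forall>i. v $ i \<in> Z} \<times> {v :: real ^ 'n. \<forall>i. v $ i \<in> {0..max 1 (B / \<delta>)}}"
  have "bounded ?K" by (intro bounded_Times bounded_vec bdd bounded_closed_interval)
  moreover have "range (\<lambda>k. (z k, l k)) \<subseteq> ?K" using zZ l0 l_le by auto
  ultimately have "bounded (range (\<lambda>k. (z k, l k)))" by (rule bounded_subset)
  then obtain y \<rho> where \<rho>: "strict_mono (\<rho> :: nat \<Rightarrow> nat)" and "((\<lambda>k. (z k, l k)) \<circ> \<rho>) \<longlonglongrightarrow> y"
    using bounded_imp_convergent_subsequence by blast
  moreover obtain z0 l0' where y: "y = (z0, l0')" by (cases y)
  ultimately have zlim: "(\<lambda>k. z (\<rho> k)) \<longlonglongrightarrow> z0" and llim: "(\<lambda>k. l (\<rho> k)) \<longlonglongrightarrow> l0'"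
    using tendsto_fst tendsto_snd by (force simp: o_def)+
  have z0: "z0 $ i \<in> Z" for i
    using unc_set_closed zZ tendsto_vec_nth[OF zlim, of i] by (rule closed_sequentially)
  have l0': "0 \<le> l0' $ i" for i
    using tendsto_vec_nth[OF llim, of i] by (rule LIMSEQ_le_const) (use l0 in auto)
  have "l0' $ o\<^sub>0 = 1"
    using tendsto_vec_nth[OF llim, of o\<^sub>0] by (rule LIMSEQ_unique) (simp add: l1)
  then have "(z0, l0') \<in> mult_set" using z0 l0' by (simp add: mult_set_def)
  moreover have "fst e0 \<bullet> x - lagr x (z0, l0') \<le> snd e0" for x
  proof (rule LIMSEQ_le)
    show "(\<lambda>k. u (\<rho> k) \<bullet> x - lagr x (z (\<rho> k), l (\<rho> k))) \<longlonglongrightarrow> fst e0 \<bullet> x - lagr x (z0, l0')"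
      using LIMSEQ_subseq_LIMSEQ[OF ulim \<rho>]
      by (intro tendsto_intros lagr_tendsto zlim llim) (simp add: o_def)
    show "(\<lambda>k. r (\<rho> k)) \<longlonglongrightarrow> snd e0"
      using LIMSEQ_subseq_LIMSEQ[OF rlim \<rho>] by (simp add: o_def)
    show "\<exists>N. \<forall>k\<ge>N. u (\<rho> k) \<bullet> x - lagr x (z (\<rho> k), l (\<rho> k)) \<le> r (\<rho> k)" using le by blast
  qed
  ultimately have "(fst e0, snd e0) \<in> conj_epi" unfolding conj_epi_def by blast
  then show "e0 \<in> conj_epi" by simp
qed

text \<open>Finitely many strict inequalities give a common slack \<delta>, hence a closed
  \<open>conj_epi\<close>, and \<open>dual_attained\<close> applies at the primal value. If that
  value is minus infinity, weak duality makes the dual infeasible, hence solvable by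
  convention.\<close>

lemma strong_duality_dual_attained:
  assumes bdd: "bounded Z"
    and x0: "strict_slater_min (PW_fun fe Z o\<^sub>0) (PW_ineqs fe Z o\<^sub>0) {} x0"
  shows "pval = dval" "solvable_max obj (DB_ineqs L c o\<^sub>0) (DB_eqs o\<^sub>0)"
proof -
  have feas: "x0 \<in> constr_set (PW_ineqs fe Z o\<^sub>0) {}"
    using x0 by (simp add: strict_slater_min_def strict_slater_def)
  have "x0 \<in> edom (PW_fun fe Z o\<^sub>0)"
    using x0 rel_interior_subset by (auto simp: strict_slater_min_def)
  then obtain M where M: "PW_fun fe Z o\<^sub>0 x0 \<le> ereal M"
    by (cases "PW_fun fe Z o\<^sub>0 x0") (auto simp: edom_def)
  have neg: "\<exists>d>0. \<forall>z\<in>Z. f i x0 z \<le> - d" if i: "i \<noteq> o\<^sub>0" for i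
  proof -
    have "PW_fun fe Z i x0 < 0"
      using x0 i by (auto simp: strict_slater_min_def strict_slater_def PW_ineqs_def)
    then obtain d where "PW_fun fe Z i x0 < ereal d" "ereal d < 0" using ereal_dense2 by blast
    then show ?thesis
      by (intro exI[of _ "- d"]) (auto simp: PW_fun_def dest!: less_imp_le simp: SUP_le_iff)
  qed
  then obtain d where d: "\<And>i. i \<noteq> o\<^sub>0 \<Longrightarrow> d i > 0 \<and> (\<forall>z\<in>Z. f i x0 z \<le> - d i)" by metis
  \<comment> \<open>The inserted \<open>1\<close> keeps the minimum meaningful if there are no
    constraints.\<close>
  define \<delta> where "\<delta> = Min (insert 1 (d ` (- {o\<^sub>0})))"
  have "\<delta> > 0" using d by (auto simp: \<delta>_def)
  moreover have "f i x0 z \<le> - \<delta>" if "i \<noteq> o\<^sub>0" "z \<in> Z" for i z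
  proof -
    have "\<delta> \<le> d i" unfolding \<delta>_def using that by (intro Min_le) auto
    then show ?thesis using d[OF that(1)] that(2) by force
  qed
  moreover have "f o\<^sub>0 x0 z \<le> M" if "z \<in> Z" for z
    using M that by (auto simp: PW_fun_def SUP_le_iff)
  ultimately have closed: "closed conj_epi" using closed_conj_epi[OF bdd] by blast
  have "pval \<le> PW_fun fe Z o\<^sub>0 x0" unfolding val_min_def using feas by (rule INF_lower)
  then have fin: "pval \<noteq> \<infinity>" using M by auto
  have "pval = dval \<and> solvable_max obj (DB_ineqs L c o\<^sub>0) (DB_eqs o\<^sub>0)"
  proof (cases "pval = - \<infinity>")
    case True
    then have dval: "dval = - \<infinity>" using weak_duality_val by simp
    then have "obj d = - \<infinity>" if "d \<in> constr_set (DB_ineqs L c o\<^sub>0) (DB_eqs o\<^sub>0)" for d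
      using SUP_upper[OF that, of obj] by (simp add: val_max_def)
    then show ?thesis using dval True by (auto simp: solvable_max_def feasible_max_def)
  next
    case False
    then obtain m where m: "pval = ereal m" using fin by (cases pval) auto
    have lower: "\<forall>x v. (\<forall>y\<in>mult_set. lagr x y \<le> v) \<longrightarrow> m \<le> v"
    proof (intro allI impI)
      fix x v assume "\<forall>y\<in>mult_set. lagr x y \<le> v"
      then have x: "x \<in> constr_set (PW_ineqs fe Z o\<^sub>0) {}" "PW_fun fe Z o\<^sub>0 x \<le> ereal v"
        by (simp_all add: lagr_le_iff)
      have "pval \<le> PW_fun fe Z o\<^sub>0 x" unfolding val_min_def using x(1) by (rule INF_lower)
      then have "pval \<le> ereal v" using x(2) by (rule order_trans)
      then show "m \<le> v" by (simp add: m)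
    qed
    have "\<forall>y\<in>mult_set. lagr x0 y \<le> M" using feas M by (simp add: lagr_le_iff)
    from dual_attained[OF closed this lower]
    obtain d where d: "d \<in> constr_set (DB_ineqs L c o\<^sub>0) (DB_eqs o\<^sub>0)" "pval \<le> obj d"
      unfolding dual_feasible_iff m by blast
    then have "obj d \<le> dval" unfolding val_max_def by (intro SUP_upper)
    then have "pval = dval" "obj d = dval" using d(2) weak_duality_val by auto
    then show ?thesis
      unfolding solvable_max_def feasible_max_def
      using d(1) m by (intro conjI disjI2 bexI[of _ d]) auto
  qed
  then show "pval = dval" "solvable_max obj (DB_ineqs L c o\<^sub>0) (DB_eqs o\<^sub>0)" by auto
qed

subsection \<open>Slater points of the dual problem\<close>

text \<open>The segment from \<open>z\<close> to the Slater component can be prolonged inside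
  \<open>Z\<close>: relative interiority keeps each \<open>c k\<close> finite a little further on,
  and convexity together with the strict slack keeps it negative close to the Slater
  component.\<close>

lemma slater_unc_set_extend:
  assumes slater: "strict_slater (DB_ineqs L c o\<^sub>0) H (w0 :: 'x ^ 'n, z0, l0)" and z: "z \<in> Z"
  shows "eventually (\<lambda>t. z0 $ i + t *\<^sub>R (z0 $ i - z) \<in> Z) (at_right 0)"
proof -
  have "eventually (\<lambda>t. c k (z0 $ i + t *\<^sub>R (z0 $ i - z)) \<le> 0) (at_right 0)" if k: "k \<in> {1..L}" for k
  proof -
    define g where "g = (\<lambda>(w :: 'x ^ 'n, z :: 'z ^ 'n, l :: real ^ 'n). c k (z $ i))"
    have "g \<in> DB_ineqs L c o\<^sub>0" using k by (auto simp: g_def DB_ineqs_def)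
    then have ri: "(w0, z0, l0) \<in> rel_interior (edom g)" and "g (w0, z0, l0) < 0"
      using slater by (auto simp: strict_slater_def)
    then have neg: "c k (z0 $ i) < 0" by (simp add: g_def)
    \<comment> \<open>Only the \<open>i\<close>-th component moves, since the relative interior is
      taken in the full dual space.\<close>
    define zi where "zi = (\<chi> j. if j = i then z else z0 $ j)"
    define q where "q t = (w0, z0, l0) + t *\<^sub>R ((w0, z0, l0) - (w0, zi, l0))" for t
    have "c k z \<le> 0" using z k by (simp add: unc_set_def)
    then have "(w0, zi, l0) \<in> edom g" by (auto simp: edom_def g_def zi_def)
    moreover have "(w0, z0, l0) \<in> edom g" using ri by (rule subsetD[OF rel_interior_subset])
    ultimately have aff: "q t \<in> affine hull (edom g)" for t
      unfolding q_def by (metis mem_affine_3_minus affine_affine_hull hull_inc)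
    have "(q \<longlongrightarrow> (w0, z0, l0) + 0 *\<^sub>R ((w0, z0, l0) - (w0, zi, l0))) (at_right 0)"
      unfolding q_def by (intro tendsto_intros)
    then have "eventually (\<lambda>t. q t \<in> edom g) (at_right 0)"
      by (intro rel_interior_eventually[OF ri] always_eventually allI aff) simp
    then have "eventually (\<lambda>t. q t \<in> edom g \<and> t > 0) (at_right 0)"
      using eventually_at_right_less by (rule eventually_conj)
    then obtain T where T: "T > 0" "q T \<in> edom g"
      using eventually_happens'[OF trivial_limit_at_right_real] by blast
    define p where "p = z0 $ i + T *\<^sub>R (z0 $ i - z)"
    have "c k p < \<infinity>" using T(2) by (simp add: edom_def g_def q_def zi_def p_def)
    then obtain b where b: "c k p \<le> ereal b" by (cases "c k p") auto
    obtain a where a: "c k (z0 $ i) < ereal a" "ereal a < 0" using neg ereal_dense2 by blast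
    \<comment> \<open>On the segment from \<open>z0 $ i\<close> to \<open>p\<close>,
      \<open>c k\<close> lies below the interpolation between \<open>a < 0\<close> and
      \<open>b\<close>, which is negative for small \<open>t\<close>.\<close>
    have "((\<lambda>t. (1 - t / T) * a + t / T * b) \<longlongrightarrow> (1 - 0 / T) * a + 0 / T * b) (at_right 0)"
      using T(1) by (intro tendsto_intros) auto
    then have "eventually (\<lambda>t. (1 - t / T) * a + t / T * b < 0) (at_right 0)"
      using a(2) by (intro order_tendstoD(2)) auto
    moreover have "eventually (\<lambda>t. t \<in> {0<..<T}) (at_right 0)"
      using T(1) by (rule eventually_at_right_real)
    ultimately show ?thesis
    proof eventually_elim
      case (elim t)
      have "(1 - t / T) *\<^sub>R (z0 $ i, a) + (t / T) *\<^sub>R (p, b) \<in> {(x, t). c k x \<le> ereal t}"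
        using constr[OF k] elim T(1) a b unfolding convex_fun_def by (intro convexD) auto
      moreover have "(1 - t / T) *\<^sub>R (z0 $ i) + (t / T) *\<^sub>R p = z0 $ i + t *\<^sub>R (z0 $ i - z)"
        using T(1) by (simp add: p_def algebra_simps)
      ultimately have "c k (z0 $ i + t *\<^sub>R (z0 $ i - z)) \<le> ereal ((1 - t / T) * a + t / T * b)"
        by simp
      also have "\<dots> \<le> 0" using elim by simp
      finally show ?case .
    qed
  qed
  then have "eventually (\<lambda>t. \<forall>k\<in>{1..L}. c k (z0 $ i + t *\<^sub>R (z0 $ i - z)) \<le> 0) (at_right 0)"
    by (intro eventually_ball_finite) auto
  then show ?thesis by (simp add: unc_set_def)
qed

lemma edom_neg_obj_iff: "d \<in> edom (\<lambda>d. - obj d) \<longleftrightarrow> (\<exists>r. ereal (- r) \<le> obj d)"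
proof
  assume "d \<in> edom (\<lambda>d. - obj d)"
  then have "- \<infinity> < obj d" by (cases "obj d") (auto simp: edom_def)
  then obtain r where "ereal r < obj d" using ereal_dense2 by blast
  then show "\<exists>r. ereal (- r) \<le> obj d" by (intro exI[of _ "- r"]) auto
next
  assume "\<exists>r. ereal (- r) \<le> obj d"
  then show "d \<in> edom (\<lambda>d. - obj d)" by (cases "obj d") (auto simp: edom_def)
qed

text \<open>
  A vanishing multiplier leaves its uncertain parameter unrestricted, so the affine hull of the
  domain contains all directions in those parameters.
\<close>

lemma affine_hull_edom_add_unc:
  assumes d: "d \<in> affine hull (edom (\<lambda>d. - obj d))"
    and dom: "(w0, z0, l0) \<in> edom (\<lambda>d. - obj d)" and \<zeta>: "\<zeta> $ o\<^sub>0 = 0"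
  shows "d + (0, \<zeta>, 0) \<in> affine hull (edom (\<lambda>d. - obj d))"
proof -
  \<comment> \<open>At multiplier \<open>0\<close> the objective stays finite only for
    \<open>w $ i = 0\<close>, so only the component at \<open>o\<^sub>0\<close> is kept.\<close>
  define w where "w = (\<chi> i. if i = o\<^sub>0 then w0 $ i else 0)"
  obtain r s where s: "\<And>i x. w0 $ i \<bullet> x - unit_mult l0 $ i * f i x (z0 $ i) \<le> s i"
    using dom unfolding edom_neg_obj_iff obj_ge_iff by blast
  have "(w, z, 0) \<in> affine hull (edom (\<lambda>d. - obj d))" if z: "z $ o\<^sub>0 = z0 $ o\<^sub>0" for z
  proof (rule hull_inc)
    have "w $ i \<bullet> x - unit_mult 0 $ i * f i x (z $ i) \<le> (if i = o\<^sub>0 then s i else 0)" for i x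
      using s[of i x] z by (cases "i = o\<^sub>0") (auto simp: w_def unit_mult_nth)
    then show "(w, z, 0) \<in> edom (\<lambda>d. - obj d)"
      unfolding edom_neg_obj_iff obj_ge_iff
      by (auto intro!: exI[of _ "\<lambda>i. if i = o\<^sub>0 then s i else 0"])
  qed
  from this[of "z0 + \<zeta>"] this[of z0]
  have "d + 1 *\<^sub>R ((w, z0 + \<zeta>, 0) - (w, z0, 0)) \<in> affine hull (edom (\<lambda>d. - obj d))"
    using \<zeta> d by (intro mem_affine_3_minus affine_affine_hull) auto
  then show ?thesis by simp
qed

text \<open>It suffices to prolong each \<open>u\<close> in the projection beyond \<open>0\<close>.
  A dual triple producing \<open>u\<close> is joined to the Slater point, whose components of
  \<open>w\<close> sum to \<open>0\<close>; moving slightly past that point stays feasible with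
  finite objective and produces \<open>- t *\<^sub>R u\<close>.\<close>

lemma slater_imp_rel_interior:
  assumes slater: "strict_slater_max obj (DB_ineqs L c o\<^sub>0) (DB_eqs o\<^sub>0) d0"
  shows "0 \<in> rel_interior (fst ` conj_epi)"
proof -
  let ?D = "edom (\<lambda>d. - obj d)"
  obtain w0 z0 l0 where d0: "d0 = (w0, z0, l0)" by (cases d0)
  have ss: "strict_slater (DB_ineqs L c o\<^sub>0) (DB_eqs o\<^sub>0) (w0, z0, l0)"
    and ri: "(w0, z0, l0) \<in> rel_interior ?D"
    using slater d0 by (auto simp: strict_slater_max_def)
  have w0: "(\<Sum>i\<in>UNIV. w0 $ i) = 0" and z0: "\<And>i. z0 $ i \<in> Z" and l0: "l0 $ o\<^sub>0 = 0"
    using ss by (auto simp: strict_slater_def constr_set_iff)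
  have l0_pos: "0 < l0 $ i" if i: "i \<noteq> o\<^sub>0" for i
  proof -
    have "(\<lambda>(w :: 'x ^ 'n, z :: 'z ^ 'n, l). ereal (- (l $ i))) \<in> DB_ineqs L c o\<^sub>0"
      using i by (auto simp: DB_ineqs_def)
    then show ?thesis using ss by (fastforce simp: strict_slater_def)
  qed
  have D0: "(w0, z0, l0) \<in> ?D" using ri rel_interior_subset by blast
  have in_epi: "\<exists>r. (\<Sum>i\<in>UNIV. w $ i, r) \<in> conj_epi"
    if "\<And>i. z $ i \<in> Z" "\<And>i. i \<noteq> o\<^sub>0 \<Longrightarrow> 0 \<le> l $ i" "l $ o\<^sub>0 = 0" "(w, z, l) \<in> ?D" for w z l
    using that unfolding conj_epi_iff edom_neg_obj_iff by blast
  have "\<exists>e>1. (1 - e) *\<^sub>R u + e *\<^sub>R 0 \<in> fst ` conj_epi" if "u \<in> fst ` conj_epi" for u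
  proof -
    obtain r where "(u, r) \<in> conj_epi" using \<open>u \<in> fst ` conj_epi\<close> by auto
    then obtain w z l where w: "(\<Sum>i\<in>UNIV. w $ i) = u" and z: "\<And>i. z $ i \<in> Z"
      and l: "\<And>i. i \<noteq> o\<^sub>0 \<Longrightarrow> 0 \<le> l $ i" "l $ o\<^sub>0 = 0" and D: "(w, z, l) \<in> ?D"
      unfolding conj_epi_iff edom_neg_obj_iff by blast
    \<comment> \<open>The line from \<open>(w, z, l)\<close> through the Slater point, straight in the coordinates
      \<open>(w, l\<^sub>i z\<^sub>i, l)\<close>, in which the domain is convex.\<close>
    define W where "W t = w0 + t *\<^sub>R (w0 - w)" for t
    define \<Lambda> where "\<Lambda> t = l0 + t *\<^sub>R (l0 - l)" for t
    \<comment> \<open>This factor solves \<open>\<Lambda> t $ i *\<^sub>R (z0 + \<zeta> t) $ i = ((1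
      + t) * l0 $ i) *\<^sub>R z0 $ i - (t * l $ i) *\<^sub>R z $ i\<close>. At
      \<open>o\<^sub>0\<close> all effective multipliers are \<open>1\<close>, which leaves
      \<open>t\<close>.\<close>
    define \<tau> where "\<tau> t i = (if i = o\<^sub>0 then t else t * l $ i / \<Lambda> t $ i)" for t i
    define \<zeta> where "\<zeta> t = (\<chi> i. \<tau> t i *\<^sub>R (z0 $ i - z $ i))" for t
    have W: "(W \<longlongrightarrow> w0) (at_right 0)"
      unfolding W_def by (auto intro!: tendsto_eq_intros)
    have \<Lambda>: "(\<Lambda> \<longlongrightarrow> l0) (at_right 0)"
      unfolding \<Lambda>_def by (auto intro!: tendsto_eq_intros)
    have \<tau>: "((\<lambda>t. \<tau> t i) \<longlongrightarrow> 0) (at_right 0)" for i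
    proof (cases "i = o\<^sub>0")
      case False
      have "((\<lambda>t. t * l $ i / \<Lambda> t $ i) \<longlongrightarrow> 0 * l $ i / l0 $ i) (at_right 0)"
        using l0_pos[OF False] by (intro tendsto_intros tendsto_vec_nth[OF \<Lambda>]) auto
      then show ?thesis using False by (simp add: \<tau>_def)
    qed (simp add: \<tau>_def)
    have "(\<zeta> \<longlongrightarrow> (\<chi> i. 0 *\<^sub>R (z0 $ i - z $ i))) (at_right 0)"
      unfolding \<zeta>_def by (intro tendsto_vec_lambda tendsto_intros \<tau>)
    then have \<zeta>: "(\<zeta> \<longlongrightarrow> 0) (at_right 0)" by (simp add: zero_vec_def)
    have \<Lambda>_pos: "eventually (\<lambda>t. \<forall>i. i \<noteq> o\<^sub>0 \<longrightarrow> 0 < \<Lambda> t $ i) (at_right 0)"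
      using order_tendstoD(1)[OF tendsto_vec_nth[OF \<Lambda>] l0_pos]
      by (intro eventually_all_finite) (auto intro: eventually_mono)
    have in_Z: "eventually (\<lambda>t. \<forall>i. (z0 + \<zeta> t) $ i \<in> Z) (at_right 0)"
    proof (rule eventually_all_finite)
      fix i
      have "eventually (\<lambda>t. z0 $ i + t *\<^sub>R (z0 $ i - z $ i) \<in> Z) (at_right 0)"
        by (rule slater_unc_set_extend[OF ss z])
      then obtain b where b: "b > 0" "\<And>t. 0 < t \<Longrightarrow> t < b \<Longrightarrow> z0 $ i + t *\<^sub>R (z0 $ i - z $ i) \<in> Z"
        by (auto simp: eventually_at_right_field)
      have "eventually (\<lambda>t. \<tau> t i < b) (at_right 0)"
        using order_tendstoD(2)[OF \<tau> b(1)] .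
      moreover have "eventually (\<lambda>t :: real. 0 < t) (at_right 0)"
        by (rule eventually_at_right_less)
      ultimately show "eventually (\<lambda>t. (z0 + \<zeta> t) $ i \<in> Z) (at_right 0)"
        using \<Lambda>_pos
      proof eventually_elim
        case (elim t)
        have "0 \<le> \<tau> t i" using elim l(1)[of i] by (auto simp: \<tau>_def less_imp_le)
        then show ?case
          using b(2)[of "\<tau> t i"] elim(1) z0[of i] by (cases "\<tau> t i = 0") (auto simp: \<zeta>_def)
      qed
    qed
    \<comment> \<open>The curve differs from a straight line in the affine hull only in the
      uncertain parameters, and not in the one at \<open>o\<^sub>0\<close>, where the factor is
      \<open>t\<close>; such a difference can be added within the hull.\<close>
    have aff: "(W t, z0 + \<zeta> t, \<Lambda> t) \<in> affine hull ?D" for t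
    proof -
      have "(w0, z0, l0) + t *\<^sub>R ((w0, z0, l0) - (w, z, l)) \<in> affine hull ?D"
        using D0 D by (intro mem_affine_3_minus affine_affine_hull hull_inc)
      from affine_hull_edom_add_unc[OF this D0, of "\<zeta> t - t *\<^sub>R (z0 - z)"]
      show ?thesis by (simp add: W_def \<Lambda>_def \<zeta>_def \<tau>_def)
    qed
    have "((\<lambda>t. (W t, z0 + \<zeta> t, \<Lambda> t)) \<longlongrightarrow> (w0, z0 + 0, l0)) (at_right 0)"
      by (intro tendsto_intros W \<zeta> \<Lambda>)
    then have "eventually (\<lambda>t. (W t, z0 + \<zeta> t, \<Lambda> t) \<in> ?D) (at_right 0)"
      by (intro rel_interior_eventually[OF ri] always_eventually allI aff) simp
    then have "eventually (\<lambda>t. (W t, z0 + \<zeta> t, \<Lambda> t) \<in> ?D \<and> (\<forall>i. (z0 + \<zeta> t) $ i \<in> Z) \<and>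
        (\<forall>i. i \<noteq> o\<^sub>0 \<longrightarrow> 0 < \<Lambda> t $ i) \<and> 0 < t) (at_right 0)"
      by (intro eventually_conj in_Z \<Lambda>_pos eventually_at_right_less)
    then obtain t where t: "(W t, z0 + \<zeta> t, \<Lambda> t) \<in> ?D" "\<And>i. (z0 + \<zeta> t) $ i \<in> Z"
      "\<And>i. i \<noteq> o\<^sub>0 \<Longrightarrow> 0 < \<Lambda> t $ i" "0 < t"
      using eventually_happens'[OF trivial_limit_at_right_real] by blast
    have "\<Lambda> t $ o\<^sub>0 = 0" by (simp add: \<Lambda>_def l l0)
    then obtain r' where "(\<Sum>i\<in>UNIV. W t $ i, r') \<in> conj_epi"
      using in_epi[of "z0 + \<zeta> t" "\<Lambda> t" "W t"] t less_imp_le by metis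
    moreover have "(\<Sum>i\<in>UNIV. W t $ i) = (1 - (1 + t)) *\<^sub>R u + (1 + t) *\<^sub>R 0"
      by (simp add: W_def sum.distrib sum_subtractf w w0 flip: scaleR_sum_right)
    ultimately show ?thesis
      using t(4) by (intro exI[of _ "1 + t"]) (force simp: image_iff)
  qed
  moreover have "fst ` conj_epi \<noteq> {}"
    using in_epi[OF z0 less_imp_le[OF l0_pos] l0 D0] by auto
  ultimately show ?thesis
    using convex_rel_interior_iff[OF convex_linear_image[OF linear_fst convex_conj_epi]] by blast
qed

end

theorem theorem7:
  fixes L :: nat
    and c :: "nat \<Rightarrow> 'z::euclidean_space \<Rightarrow> ereal"
    and f :: "'n::finite \<Rightarrow> 'x::euclidean_space \<Rightarrow> 'z \<Rightarrow> ereal"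
    and o\<^sub>0 :: 'n
  defines "Z \<equiv> unc_set L c"
  assumes "Z \<noteq> {}"
    and "\<And>l. l \<in> {1..L} \<Longrightarrow> proper_fun (c l) \<and> closed_fun (c l) \<and> convex_fun (c l)"
    and "\<And>i z. proper_fun (\<lambda>x. f i x z) \<and> closed_fun (\<lambda>x. f i x z) \<and> convex_fun (\<lambda>x. f i x z)"
    and "\<And>i x. proper_fun (\<lambda>z. - f i x z) \<and> closed_fun (\<lambda>z. - f i x z) \<and> convex_fun (\<lambda>z. - f i x z)"
  shows
    "((\<exists>x. strict_slater_min (PW_fun f Z o\<^sub>0) (PW_ineqs f Z o\<^sub>0) {} x) \<and> bounded Z \<longrightarrow>
        val_min (PW_fun f Z o\<^sub>0) (PW_ineqs f Z o\<^sub>0) {}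
          = val_max (DB_obj f o\<^sub>0) (DB_ineqs L c o\<^sub>0) (DB_eqs o\<^sub>0) \<and>
        solvable_max (DB_obj f o\<^sub>0) (DB_ineqs L c o\<^sub>0) (DB_eqs o\<^sub>0)) \<and>
     (feasible_min (PW_fun f Z o\<^sub>0) (PW_ineqs f Z o\<^sub>0) {} \<noteq> {} \<and>
        bounded (feasible_min (PW_fun f Z o\<^sub>0) (PW_ineqs f Z o\<^sub>0) {}) \<and> bounded Z \<longrightarrow>
        val_min (PW_fun f Z o\<^sub>0) (PW_ineqs f Z o\<^sub>0) {}
          = val_max (DB_obj f o\<^sub>0) (DB_ineqs L c o\<^sub>0) (DB_eqs o\<^sub>0) \<and>
        solvable_min (PW_fun f Z o\<^sub>0) (PW_ineqs f Z o\<^sub>0) {}) \<and>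
     ((\<exists>s. strict_slater_max (DB_obj f o\<^sub>0) (DB_ineqs L c o\<^sub>0) (DB_eqs o\<^sub>0) s) \<longrightarrow>
        val_max (DB_obj f o\<^sub>0) (DB_ineqs L c o\<^sub>0) (DB_eqs o\<^sub>0)
          = val_min (PW_fun f Z o\<^sub>0) (PW_ineqs f Z o\<^sub>0) {} \<and>
        solvable_min (PW_fun f Z o\<^sub>0) (PW_ineqs f Z o\<^sub>0) {})"
proof -
  define g where "g i x z = real_of_ereal (f i x z)" for i x z
  \<comment> \<open>Properness in both arguments excludes both infinities.\<close>
  have fg: "f i x z = ereal (g i x z)" for i x z
  proof -
    have "- \<infinity> < f i x z" "- \<infinity> < - f i x z"
      using assms(4)[of i z] assms(5)[of i x] by (auto simp: proper_fun_def)
    then show ?thesis by (cases "f i x z") (auto simp: g_def)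
  qed
  then have f: "f = (\<lambda>i x z. ereal (g i x z))" by (intro ext)
  interpret robust_problem L c g o\<^sub>0
  proof
    show "unc_set L c \<noteq> {}" using assms(2) by (simp add: Z_def)
    show "proper_fun (c l) \<and> closed_fun (c l) \<and> convex_fun (c l)" if "l \<in> {1..L}" for l
      using assms(3)[OF that] .
    show "convex_on UNIV (\<lambda>x. g i x z)" for i z
      using assms(4)[of i z] by (intro convex_on_of_convex_fun) (simp add: fg)
    show "convex_on UNIV (\<lambda>z. - g i x z)" for i x
      using assms(5)[of i x] by (intro convex_on_of_convex_fun) (simp add: fg)
  qed
  \<comment> \<open>Claim (i) is dual attainment; (ii) and (iii) share primal attainment and differ
    in how the relative interior condition is obtained.\<close>
  show ?thesis
    unfolding Z_def f
    using strong_duality_dual_attained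
      strong_duality_primal_attained[OF bounded_feasible_imp_rel_interior]
      strong_duality_primal_attained[OF slater_imp_rel_interior]
    by auto
qed

end
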